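(* (Supersymmetry boson-fermion) Let $\mathfrak g$ be a simple finite-dimensional complex Lie algebra with dual Coxeter number $g$, $\ell\in\mathbb N$, $d=\ell+g$. On $H=L(V_0,\ell)\otimes\mathcal F_{NS}^{\mathfrak g}$, with boson fields $B^a$, fermion fields $\psi^a$ and SuperVirasoro operator $G$, $$B^a(z)G(w)\sim d^{1/2}\frac{\psi^a(w)}{(z-w)^2},\qquad\psi^a(z)G(w)\sim d^{-1/2}\frac{B^a(w)}{(z-w)},$$ $$[G_m,B^a_n]=-n\,d^{1/2}\psi^a_{m+n},\qquad[G_m,\psi^a_n]_+=d^{-1/2}B^a_{m+n}.$$
   Context: Lie algebra data. $\mathfrak g$ has a basis $(X_a)_{1\le a\le\dim\mathfrak g}$ with $[X_a,X_b]=i\sum_c\Gamma_{ab}^cX_c$, $\Gamma_{ab}^c\in\mathbb R$ totally antisymmetric, normalized so that $\sum_aX_a^2$ is exactly the Casimir (highest root of squared length 2); then $\sum_{a,c}\Gamma_{ac}^b\Gamma_{ac}^d=2g\,\delta_{bd}$. $\widehat{\mathfrak g}_+$ is spanned by $X^a_n$ ($n\in\mathbb Z$) and a central $\mathcal L$, with $[X_m^a,X_n^b]=i\sum_c\Gamma_{ab}^cX^c_{m+n}+m\,\delta_{ab}\delta_{m+n,0}\mathcal L$, $(X_n^a)^\star=X_{-n}^a$. $L(V_0,\ell)$ is its irreducible unitary highest weight representation with $\mathcal L=\ell$ and trivial one-dimensional lowest energy subspace. $\widehat{\mathfrak g}_-$ is generated by $\psi^a_m$, $m\in\mathbb Z+\frac12$,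 with $[\psi^a_m,\psi^b_n]_+=\delta_{ab}\delta_{m+n,0}$, $(\psi^a_m)^\star=\psi^a_{-m}$; $\mathcal F_{NS}^{\mathfrak g}$ is its irreducible unitary representation generated by a unit vector annihilated by $\psi^a_m$, $m>0$. On $H$, $X^a_n$ acts on the first factor, $\psi^a_m$ on the second; $\Omega$ is the tensor product of the two unit vacuum vectors. Fields. For a series $A(z)=\sum_{n\in\mathbb Z}A(n)z^{-n-1}$ of operators and $A,B$ mutually local with sign $\varepsilon\in\mathbb Z_2$ (i.e. in all matrix coefficients $A(z)B(w)$ for $|z|>|w|$ and $(-1)^\varepsilon B(w)A(z)$ for $|w|>|z|$ are expansions of the same element of $(z-w)^{-N}\mathbb C[z^{\pm1},w^{\pm1}]$ for some $N$), put $[X,Y]_\varepsilon=XY-(-1)^\varepsilon YX$ and $A_nB(w)=\sum_m(A_nB)(m)w^{-m-1}$ with $(A_nB)(m)=\sum_{p=0}^n(-1)^p\binom np[A(n-p),B(m+p)]_\varepsilon$ if $n\ge0$, $(A_nB)(m)=\sum_{p\ge0}\binom{p-n-1}p\big(A(n-p)B(m+p)-(-1)^{\varepsilon+n}B(m+n-p)A(p)\big)$ if $n<0$. The notation $A(z)B(w)\sim\sum_{n=0}^{N-1}\frac{C_n(w)}{(z-w)^{n+1}}$ means $A_nB=C_n$ for $0\le n<N$ and $A_nB=0$ for $n\ge N$. Fields here: $\psi^a(z)=\sum_n\psi^a_{n+1/2}z^{-n-1}$, $X^a(z)=\sum_nX^a_nz^{-n-1}$, $S^c(z)=\sum_nS^c_nz^{-n-1}=-\frac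 i2\sum_{a,b}\Gamma_{ab}^c\,\psi^a_{-1}\psi^b(z)$ (operation $A_{-1}B$ on fields), $B^a_n=X^a_n+S^a_n$, $B^a(z)=\sum_n B^a_nz^{-n-1}$. The SuperVirasoro operator is $$G(z)=\sum_{m\in\mathbb Z+1/2}G_mz^{-m-3/2}=(\ell+g)^{-1/2}\sum_a\Big(\psi^a_{-1}X^a(z)+\tfrac13\psi^a_{-1}S^a(z)\Big),$$ i.e. $G(z)=V(\tau,z)$ is the field, in the vertex operator superalgebra generated on $H$ by the $\psi^a$ and $X^a$, attached to $\tau=(\ell+g)^{-1/2}\big(\sum_a\psi^a_{-1/2}X^a_{-1}\Omega+\frac13\sum_a\psi^a_{-1/2}S^a_{-1}\Omega\big)$. *)

theory Defs
  imports Complex_Main "HOL-Library.Groups_Big_Fun"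
begin

section \<open>Complex vector spaces and complex inner product spaces\<close>

class complex_vector = ab_group_add +
  fixes scaleC :: "complex \<Rightarrow> 'a \<Rightarrow> 'a" (infixr "*\<^sub>C" 75)
  assumes scaleC_add_right: "c *\<^sub>C (u + v) = c *\<^sub>C u + c *\<^sub>C v"
    and scaleC_add_left: "(b + c) *\<^sub>C v = b *\<^sub>C v + c *\<^sub>C v"
    and scaleC_scaleC: "b *\<^sub>C c *\<^sub>C v = (b * c) *\<^sub>C v"
    and scaleC_one: "1 *\<^sub>C v = v"

global_interpretation cvec: vector_space "scaleC :: complex \<Rightarrow> 'a \<Rightarrow> 'a::complex_vector"
  by unfold_locales (simp_all add: scaleC_add_right scaleC_add_left scaleC_scaleC scaleC_one)

text \<open>Inner products are linear in the first argument. No completeness is required: the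
  representations below are spaces of finite energy vectors.\<close>

class complex_inner = complex_vector +
  fixes cinner :: "'a \<Rightarrow> 'a \<Rightarrow> complex"
  assumes cinner_add_left: "cinner (u + v) w = cinner u w + cinner v w"
    and cinner_scaleC_left: "cinner (c *\<^sub>C u) v = c * cinner u v"
    and cinner_commute: "cinner u v = cnj (cinner v u)"
    and cinner_pos: "u \<noteq> 0 \<Longrightarrow> 0 < Re (cinner u u)"

abbreviation clinear :: "('a::complex_vector \<Rightarrow> 'b::complex_vector) \<Rightarrow> bool" where
  "clinear \<equiv> Vector_Spaces.linear scaleC scaleC"

definition cbilinear :: "('a::complex_vector \<Rightarrow> 'b::complex_vector \<Rightarrow> 'c::complex_vector) \<Rightarrow> bool" where
  "cbilinear f \<longleftrightarrow> (\<forall>u. clinear (f u)) \<and> (\<forall>v. clinear (\<lambda>u. f u v))"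

definition is_cbasis :: "('i \<Rightarrow> 'a::complex_vector) \<Rightarrow> bool" where
  "is_cbasis x \<longleftrightarrow> inj x \<and> cvec.independent (range x) \<and> cvec.span (range x) = UNIV"

text \<open>The algebraic tensor product of two inner product spaces. The formula for the inner
  product forces the linear map from the abstract tensor product to be injective, and the span
  condition forces it to be surjective.\<close>

definition is_tensor_product ::
  "('l::complex_inner \<Rightarrow> 'f::complex_inner \<Rightarrow> 'h::complex_inner) \<Rightarrow> bool" where
  "is_tensor_product t \<longleftrightarrow>
     cbilinear t \<and>
     (\<forall>u v u' v'. cinner (t u v) (t u' v') = cinner u u' * cinner v v') \<and>
     cvec.span {t u v | u v. True} = UNIV"

definition acts_on_first ::
  "('l \<Rightarrow> 'f \<Rightarrow> 'h::complex_vector) \<Rightarrow> ('l \<Rightarrow> 'l) \<Rightarrow> ('h \<Rightarrow> 'h) \<Rightarrow> bool" where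
  "acts_on_first t T T' \<longleftrightarrow> clinear T' \<and> (\<forall>u v. T' (t u v) = t (T u) v)"

definition acts_on_second ::
  "('l \<Rightarrow> 'f \<Rightarrow> 'h::complex_vector) \<Rightarrow> ('f \<Rightarrow> 'f) \<Rightarrow> ('h \<Rightarrow> 'h) \<Rightarrow> bool" where
  "acts_on_second t T T' \<longleftrightarrow> clinear T' \<and> (\<forall>u v. T' (t u v) = t u (T v))"

definition irreducible_ops :: "('v::complex_vector \<Rightarrow> 'v) set \<Rightarrow> bool" where
  "irreducible_ops Ops \<longleftrightarrow>
     (\<exists>v::'v. v \<noteq> 0) \<and>
     (\<forall>W. cvec.subspace W \<and> (\<forall>T\<in>Ops. T ` W \<subseteq> W) \<longrightarrow> W = {0} \<or> W = UNIV)"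


section \<open>Simple Lie algebras, the normalized form, the dual Coxeter number\<close>

definition lie_bracket :: "('g::complex_vector \<Rightarrow> 'g \<Rightarrow> 'g) \<Rightarrow> bool" where
  "lie_bracket br \<longleftrightarrow>
     cbilinear br \<and> (\<forall>x. br x x = 0) \<and>
     (\<forall>x y z. br x (br y z) + br y (br z x) + br z (br x y) = 0)"

definition simple_lie_algebra :: "('g::complex_vector \<Rightarrow> 'g \<Rightarrow> 'g) \<Rightarrow> bool" where
  "simple_lie_algebra br \<longleftrightarrow>
     lie_bracket br \<and> (\<exists>x y. br x y \<noteq> 0) \<and>
     (\<forall>I. cvec.subspace I \<and> (\<forall>x. \<forall>y\<in>I. br x y \<in> I) \<longrightarrow> I = {0} \<or> I = UNIV)"

text \<open>In a semisimple complex Lie algebra the Cartan subalgebras are the maximal toral ones.\<close>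

definition toral_subalgebra :: "('g::complex_vector \<Rightarrow> 'g \<Rightarrow> 'g) \<Rightarrow> 'g set \<Rightarrow> bool" where
  "toral_subalgebra br \<hh> \<longleftrightarrow>
     cvec.subspace \<hh> \<and> (\<forall>x\<in>\<hh>. \<forall>y\<in>\<hh>. br x y = 0) \<and>
     (\<forall>x\<in>\<hh>. cvec.span {v. \<exists>c. br x v = c *\<^sub>C v} = UNIV)"

definition cartan_subalgebra :: "('g::complex_vector \<Rightarrow> 'g \<Rightarrow> 'g) \<Rightarrow> 'g set \<Rightarrow> bool" where
  "cartan_subalgebra br \<hh> \<longleftrightarrow>
     toral_subalgebra br \<hh> \<and> (\<forall>\<hh>'. toral_subalgebra br \<hh>' \<and> \<hh> \<subseteq> \<hh>' \<longrightarrow> \<hh>' = \<hh>)"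

definition invariant_form ::
  "('g::complex_vector \<Rightarrow> 'g \<Rightarrow> 'g) \<Rightarrow> ('g \<Rightarrow> 'g \<Rightarrow> complex) \<Rightarrow> bool" where
  "invariant_form br K \<longleftrightarrow>
     (\<forall>x. Vector_Spaces.linear scaleC (*) (K x)) \<and>
     (\<forall>x y. K x y = K y x) \<and>
     (\<forall>x y z. K (br x y) z = K x (br y z))"

text \<open>Roots are represented inside the Cartan subalgebra \<open>\<hh>\<close>, its dual being identified with
  \<open>\<hh>\<close> through the form: \<open>t\<close> stands for the functional \<open>K t\<close> on \<open>\<hh>\<close>. The squared length of the
  root is then \<open>K t t\<close>.\<close>

definition roots ::
  "('g::complex_vector \<Rightarrow> 'g \<Rightarrow> 'g) \<Rightarrow> ('g \<Rightarrow> 'g \<Rightarrow> complex) \<Rightarrow> 'g set \<Rightarrow> 'g set" where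
  "roots br K \<hh> = {t \<in> \<hh>. t \<noteq> 0 \<and> (\<exists>x. x \<noteq> 0 \<and> (\<forall>y\<in>\<hh>. br y x = K t y *\<^sub>C x))}"

definition nat_combination :: "'g::complex_vector set \<Rightarrow> 'g \<Rightarrow> bool" where
  "nat_combination \<Delta> v \<longleftrightarrow> (\<exists>c::'g \<Rightarrow> nat. v = (\<Sum>\<alpha>\<in>\<Delta>. of_nat (c \<alpha>) *\<^sub>C \<alpha>))"

definition is_root_base :: "'g::complex_vector set \<Rightarrow> 'g set \<Rightarrow> bool" where
  "is_root_base R \<Delta> \<longleftrightarrow>
     finite \<Delta> \<and> \<Delta> \<subseteq> R \<and> cvec.independent \<Delta> \<and>
     (\<forall>\<beta>\<in>R. nat_combination \<Delta> \<beta> \<or> nat_combination \<Delta> (- \<beta>))"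

definition is_highest_root :: "'g::complex_vector set \<Rightarrow> 'g set \<Rightarrow> 'g \<Rightarrow> bool" where
  "is_highest_root R \<Delta> \<theta> \<longleftrightarrow> \<theta> \<in> R \<and> (\<forall>\<beta>\<in>R. nat_combination \<Delta> (\<theta> - \<beta>))"

definition normalized_form ::
  "('g::complex_vector \<Rightarrow> 'g \<Rightarrow> 'g) \<Rightarrow> ('g \<Rightarrow> 'g \<Rightarrow> complex) \<Rightarrow> bool" where
  "normalized_form br K \<longleftrightarrow>
     invariant_form br K \<and>
     (\<exists>\<hh> \<Delta> \<theta>. cartan_subalgebra br \<hh> \<and> is_root_base (roots br K \<hh>) \<Delta> \<and>
        is_highest_root (roots br K \<hh>) \<Delta> \<theta> \<and> K \<theta> \<theta> = 2)"

definition orthonormal_basis :: "('g::complex_vector \<Rightarrow> 'g \<Rightarrow> complex) \<Rightarrow> 'g set \<Rightarrow> bool" where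
  "orthonormal_basis K E \<longleftrightarrow>
     cvec.independent E \<and> cvec.span E = UNIV \<and>
     (\<forall>x\<in>E. \<forall>y\<in>E. K x y = (if x = y then 1 else 0))"

text \<open>The dual Coxeter number is half the eigenvalue, in the adjoint representation, of the
  Casimir element of the normalized form.\<close>

definition is_dual_coxeter_number :: "('g::complex_vector \<Rightarrow> 'g \<Rightarrow> 'g) \<Rightarrow> nat \<Rightarrow> bool" where
  "is_dual_coxeter_number br g \<longleftrightarrow>
     (\<forall>K E. normalized_form br K \<and> finite E \<and> orthonormal_basis K E \<longrightarrow>
        (\<forall>y. (\<Sum>x\<in>E. br x (br x y)) = (2 * of_nat g) *\<^sub>C y))"


section \<open>The representations of the bosons and of the fermions\<close>

definition half_ints :: "rat set" where
  "half_ints = {m. \<exists>n::int. m = of_int n + 1/2}"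

text \<open>The last two conditions say that the lowest energy subspace, i.e. the common kernel of the
  operators of positive mode, is the line of \<open>\<Omega>\<close> and that the Lie algebra acts trivially on it.
  Every nonzero vector generates by irreducibility.\<close>

definition boson_vacuum_rep ::
  "('i::finite \<Rightarrow> 'i \<Rightarrow> 'i \<Rightarrow> real) \<Rightarrow> nat \<Rightarrow>
   ('i \<Rightarrow> int \<Rightarrow> 'l::complex_inner \<Rightarrow> 'l) \<Rightarrow> 'l \<Rightarrow> bool" where
  "boson_vacuum_rep \<Gamma> level X \<Omega> \<longleftrightarrow>
     (\<forall>a n. clinear (X a n)) \<and>
     (\<forall>a b m n v. X a m (X b n v) - X b n (X a m v) =
        (\<Sum>c\<in>UNIV. (\<i> * of_real (\<Gamma> a b c)) *\<^sub>C X c (m + n) v) +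
        (if a = b \<and> m + n = 0 then (of_int m * of_nat level) *\<^sub>C v else 0)) \<and>
     (\<forall>a n u v. cinner (X a n u) v = cinner u (X a (- n) v)) \<and>
     irreducible_ops {X a n | a n. True} \<and>
     cinner \<Omega> \<Omega> = 1 \<and>
     {v. \<forall>a n. n > 0 \<longrightarrow> X a n v = 0} = cvec.span {\<Omega>} \<and>
     (\<forall>a. X a 0 \<Omega> = 0)"

definition fermion_vacuum_rep ::
  "('i \<Rightarrow> rat \<Rightarrow> 'f::complex_inner \<Rightarrow> 'f) \<Rightarrow> 'f \<Rightarrow> bool" where
  "fermion_vacuum_rep \<psi> \<Omega> \<longleftrightarrow>
     (\<forall>a. \<forall>m\<in>half_ints. clinear (\<psi> a m)) \<and>
     (\<forall>a b v. \<forall>m\<in>half_ints. \<forall>n\<in>half_ints.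
        \<psi> a m (\<psi> b n v) + \<psi> b n (\<psi> a m v) = (if a = b \<and> m + n = 0 then v else 0)) \<and>
     (\<forall>a u v. \<forall>m\<in>half_ints. cinner (\<psi> a m u) v = cinner u (\<psi> a (- m) v)) \<and>
     irreducible_ops {\<psi> a m | a m. m \<in> half_ints} \<and>
     cinner \<Omega> \<Omega> = 1 \<and>
     (\<forall>a. \<forall>m\<in>half_ints. m > 0 \<longrightarrow> \<psi> a m \<Omega> = 0)"


section \<open>Fields and operator product expansions\<close>

text \<open>A series \<open>A(z) = \<Sum>\<^sub>n A(n) z\<^sup>-\<^sup>n\<^sup>-\<^sup>1\<close> is given by its modes \<open>A(n)\<close>.\<close>

type_synonym 'h field_series = "int \<Rightarrow> 'h \<Rightarrow> 'h"

definition super_commutator ::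
  "nat \<Rightarrow> ('h::complex_vector \<Rightarrow> 'h) \<Rightarrow> ('h \<Rightarrow> 'h) \<Rightarrow> 'h \<Rightarrow> 'h" where
  "super_commutator \<epsilon> S T v = S (T v) - ((-1) ^ \<epsilon>) *\<^sub>C T (S v)"

text \<open>For negative \<open>n\<close> the sum over \<open>p\<close> is locally finite for the fields considered here: applied
  to a vector, all but finitely many terms vanish.\<close>

definition nth_product ::
  "nat \<Rightarrow> int \<Rightarrow> 'h::complex_vector field_series \<Rightarrow> 'h field_series \<Rightarrow> 'h field_series" where
  "nth_product \<epsilon> n A B m v =
     (if n \<ge> 0 then
        (\<Sum>p\<le>nat n. ((-1) ^ p * of_nat (nat n choose p)) *\<^sub>C
            super_commutator \<epsilon> (A (n - int p)) (B (m + int p)) v)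
      else
        Sum_any (\<lambda>p::nat. of_nat (nat (int p - n - 1) choose p) *\<^sub>C
            (A (n - int p) (B (m + int p) v) -
             ((-1) powi (int \<epsilon> + n)) *\<^sub>C B (m + n - int p) (A (int p) v))))"

text \<open>Let \<open>P\<close> be the coefficient function of a Laurent polynomial, \<open>P i j\<close> being the coefficient of
  \<open>z\<^sup>i w\<^sup>j\<close>. The next two functions give the coefficient of \<open>z\<^sup>i w\<^sup>j\<close> in the expansion of
  \<open>P(z,w) (z - w)\<^sup>-\<^sup>N\<close> for \<open>|z| > |w|\<close>, where
  \<open>(z - w)\<^sup>-\<^sup>N = \<Sum>\<^sub>k (N+k-1 choose k) z\<^sup>-\<^sup>N\<^sup>-\<^sup>k w\<^sup>k\<close>, and for \<open>|w| > |z|\<close>, where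
  \<open>(z - w)\<^sup>-\<^sup>N = (-1)\<^sup>N \<Sum>\<^sub>k (N+k-1 choose k) z\<^sup>k w\<^sup>-\<^sup>N\<^sup>-\<^sup>k\<close>.\<close>

definition expand_z_gt_w :: "nat \<Rightarrow> (int \<Rightarrow> int \<Rightarrow> complex) \<Rightarrow> int \<Rightarrow> int \<Rightarrow> complex" where
  "expand_z_gt_w N P i j =
     Sum_any (\<lambda>k::nat. of_nat ((N + k - 1) choose k) * P (i + int N + int k) (j - int k))"

definition expand_w_gt_z :: "nat \<Rightarrow> (int \<Rightarrow> int \<Rightarrow> complex) \<Rightarrow> int \<Rightarrow> int \<Rightarrow> complex" where
  "expand_w_gt_z N P i j =
     (-1) ^ N * Sum_any (\<lambda>k::nat. of_nat ((N + k - 1) choose k) * P (i - int k) (j + int N + int k))"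

definition mutually_local ::
  "nat \<Rightarrow> 'h::complex_inner field_series \<Rightarrow> 'h field_series \<Rightarrow> bool" where
  "mutually_local \<epsilon> A B \<longleftrightarrow>
     (\<exists>N. \<forall>u v. \<exists>P. finite {(i, j). P i j \<noteq> 0} \<and>
        (\<forall>m n. cinner (A m (B n u)) v = expand_z_gt_w N P (- m - 1) (- n - 1) \<and>
               (-1) ^ \<epsilon> * cinner (B n (A m u)) v = expand_w_gt_z N P (- m - 1) (- n - 1)))"

text \<open>\<open>A(z)B(w) \<sim> \<Sum>\<^sub>n C\<^sub>n(w) / (z - w)\<^sup>n\<^sup>+\<^sup>1\<close> for fields that are mutually local with sign \<open>\<epsilon>\<close>;
  the list \<open>Cs\<close> is \<open>[C\<^sub>0, C\<^sub>1, \<dots>]\<close>.\<close>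

definition ope ::
  "nat \<Rightarrow> 'h::complex_inner field_series \<Rightarrow> 'h field_series \<Rightarrow> 'h field_series list \<Rightarrow> bool" where
  "ope \<epsilon> A B Cs \<longleftrightarrow>
     mutually_local \<epsilon> A B \<and>
     (\<forall>n<length Cs. nth_product \<epsilon> (int n) A B = Cs ! n) \<and>
     (\<forall>n\<ge>length Cs. nth_product \<epsilon> (int n) A B = (\<lambda>m v. 0))"


section \<open>The fields of the supersymmetric model\<close>

text \<open>Locality signs: two fermion fields have sign 1, a fermion field and a boson field sign 0.\<close>

definition psi_field :: "('i \<Rightarrow> rat \<Rightarrow> 'h \<Rightarrow> 'h) \<Rightarrow> 'i \<Rightarrow> 'h field_series" where
  "psi_field \<psi> a n = \<psi> a (of_int n + 1/2)"

definition S_field ::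
  "('i::finite \<Rightarrow> 'i \<Rightarrow> 'i \<Rightarrow> real) \<Rightarrow> ('i \<Rightarrow> rat \<Rightarrow> 'h \<Rightarrow> 'h) \<Rightarrow> 'i \<Rightarrow> 'h::complex_vector field_series"
  where
  "S_field \<Gamma> \<psi> c n v =
     (- \<i> / 2) *\<^sub>C (\<Sum>a\<in>UNIV. \<Sum>b\<in>UNIV.
        of_real (\<Gamma> a b c) *\<^sub>C nth_product 1 (- 1) (psi_field \<psi> a) (psi_field \<psi> b) n v)"

definition B_field ::
  "('i::finite \<Rightarrow> 'i \<Rightarrow> 'i \<Rightarrow> real) \<Rightarrow> ('i \<Rightarrow> int \<Rightarrow> 'h \<Rightarrow> 'h) \<Rightarrow> ('i \<Rightarrow> rat \<Rightarrow> 'h \<Rightarrow> 'h) \<Rightarrow>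
   'i \<Rightarrow> 'h::complex_vector field_series" where
  "B_field \<Gamma> X \<psi> a n v = X a n v + S_field \<Gamma> \<psi> a n v"

definition G_field ::
  "('i::finite \<Rightarrow> 'i \<Rightarrow> 'i \<Rightarrow> real) \<Rightarrow> real \<Rightarrow> ('i \<Rightarrow> int \<Rightarrow> 'h \<Rightarrow> 'h) \<Rightarrow> ('i \<Rightarrow> rat \<Rightarrow> 'h \<Rightarrow> 'h) \<Rightarrow>
   'h::complex_vector field_series" where
  "G_field \<Gamma> d X \<psi> n v =
     of_real (1 / sqrt d) *\<^sub>C (\<Sum>a\<in>UNIV.
        nth_product 0 (- 1) (psi_field \<psi> a) (X a) n v +
        (1 / 3) *\<^sub>C nth_product 0 (- 1) (psi_field \<psi> a) (S_field \<Gamma> \<psi> a) n v)"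

text \<open>The mode \<open>G\<^sub>m\<close>, \<open>m\<close> a half-integer, is the coefficient of \<open>z\<^sup>-\<^sup>m\<^sup>-\<^sup>3\<^sup>/\<^sup>2 = z\<^sup>-\<^sup>(\<^sup>m\<^sup>+\<^sup>1\<^sup>/\<^sup>2\<^sup>)\<^sup>-\<^sup>1\<close>.\<close>

definition G_mode ::
  "('i::finite \<Rightarrow> 'i \<Rightarrow> 'i \<Rightarrow> real) \<Rightarrow> real \<Rightarrow> ('i \<Rightarrow> int \<Rightarrow> 'h \<Rightarrow> 'h) \<Rightarrow> ('i \<Rightarrow> rat \<Rightarrow> 'h \<Rightarrow> 'h) \<Rightarrow>
   rat \<Rightarrow> 'h::complex_vector \<Rightarrow> 'h" where
  "G_mode \<Gamma> d X \<psi> m = G_field \<Gamma> d X \<psi> \<lfloor>m + 1/2\<rfloor>"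

end

(* All four relations are read off from commutators of modes. A commutator with a normally ordered
   product acts as a derivation on the two factors; the structure-constant terms cancel by
   antisymmetry, but shifting the left factor moves terms across the normal ordering, and the
   resulting double commutators assemble, by the Casimir identity, into a multiple of n g. Together
   with the central terms, B(n) against the bosonic part of G contributes n level, and against the
   fermionic part (n g + 2 n g) / 3 = n g, whence d = level + g. For locality, both commutators are
   annihilated by (z - w)^2, and the two orderings are truncated on opposite sides because each
   field has an adjoint field. *)

theory Submission
  imports Defs
begin

section \<open>Linear maps and sesquilinear forms\<close>

text \<open>The factor 1/3 in G reflects that the fermionic part is cubic in psi with totally
  antisymmetric coefficients: contracting it with psi^a produces S^a once from the outer fermion and
  twice more from the two fermions inside S. The same factor makes the contributions to [B, G] add
  up correctly.

  The representations come without an energy grading. That high modes annihilate a given vector, on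
  which the local finiteness of every normally ordered product rests, is therefore extracted from
  irreducibility. Identities between these infinite sums are proved by comparing partial sums with a
  common, sufficiently large cut-off.

  The Lie algebra enters the mode computation only through antisymmetry, the Jacobi identity and the
  Casimir identity for the real numbers \<Gamma>; a locale isolates the computation from the
  representations that realize it.\<close>

lemma clinearI:
  assumes "\<And>u v. f (u + v) = f u + f v" and "\<And>c v. f (c *\<^sub>C v) = c *\<^sub>C f v"
  shows "clinear f"
  unfolding Vector_Spaces.linear_iff
  by (intro conjI allI assms cvec.vector_space_axioms)

lemma
  assumes "clinear f"
  shows clinear_add: "f (u + v) = f u + f v"
    and clinear_scaleC: "f (c *\<^sub>C v) = c *\<^sub>C f v"
    and clinear_zero: "f 0 = 0"
    and clinear_diff: "f (u - v) = f u - f v"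
    and clinear_sum: "f (sum h I) = (\<Sum>i\<in>I. f (h i))"
proof -
  interpret Vector_Spaces.linear scaleC scaleC f by fact
  show "f (u + v) = f u + f v" "f (c *\<^sub>C v) = c *\<^sub>C f v" "f 0 = 0" "f (u - v) = f u - f v"
    "f (sum h I) = (\<Sum>i\<in>I. f (h i))"
    by (simp_all add: add scale zero diff sum)
qed

lemma clinear_lincomb:
  assumes "\<And>i. i \<in> I \<Longrightarrow> clinear (f i)"
  shows "clinear (\<lambda>v. \<Sum>i\<in>I. q i *\<^sub>C f i v)"
  using assms
  by (intro clinearI)
    (simp_all add: clinear_add clinear_scaleC cvec.scale_right_distrib sum.distrib
      cvec.scale_sum_right mult.commute)

lemma clinear_compose: "clinear f \<Longrightarrow> clinear g \<Longrightarrow> clinear (\<lambda>v. f (g v))"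
  by (intro clinearI) (simp_all add: clinear_add clinear_scaleC)

lemma clinear_plus: "clinear f \<Longrightarrow> clinear g \<Longrightarrow> clinear (\<lambda>v. f v + g v)"
  by (intro clinearI) (simp_all add: clinear_add clinear_scaleC cvec.scale_right_distrib)

lemma clinear_scale: "clinear f \<Longrightarrow> clinear (\<lambda>v. c *\<^sub>C f v)"
  by (intro clinearI)
    (simp_all add: clinear_add clinear_scaleC cvec.scale_right_distrib cvec.scale_left_commute)

lemma clinear_eq_on_span:
  assumes "clinear f" "clinear g" "\<And>v. v \<in> V \<Longrightarrow> f v = g v" "cvec.span V = UNIV"
  shows "f v = g v"
proof -
  have "cvec.subspace {v. f v = g v}"
    using assms(1,2)
    by (intro cvec.subspaceI) (simp_all add: clinear_add clinear_scaleC clinear_zero)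
  then have "cvec.span V \<subseteq> {v. f v = g v}"
    using assms(3) by (intro cvec.span_minimal) auto
  then show ?thesis using assms(4) by auto
qed

lemma sum_if_scaleC:
  "(\<Sum>b\<in>(UNIV :: 'i::finite set). q b *\<^sub>C (if a = b then f b else 0)) = q a *\<^sub>C f a"
  "(\<Sum>b\<in>(UNIV :: 'i::finite set). q b *\<^sub>C (if b = a then f b else 0)) = q a *\<^sub>C f a"
  by (simp_all add: if_distrib[of "(*\<^sub>C) _"] cong: if_cong)

lemma cinner_zero_left [simp]: "cinner 0 v = 0"
  using cinner_scaleC_left[of 0 0 v] by simp

lemma cinner_zero_right [simp]: "cinner v 0 = 0"
  by (subst cinner_commute) simp

lemma cinner_add_right: "cinner u (v + w) = cinner u v + cinner u w"
  by (metis cinner_add_left cinner_commute complex_cnj_add)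

lemma cinner_scaleC_right: "cinner u (c *\<^sub>C v) = cnj c * cinner u v"
  by (metis cinner_scaleC_left cinner_commute complex_cnj_mult)

lemma cinner_minus_left: "cinner (- u) v = - cinner u v"
  using cinner_scaleC_left[of "-1" u v] by simp

lemma cinner_diff_left: "cinner (u - w) v = cinner u v - cinner w v"
  using cinner_add_left[of u "- w" v] by (simp add: cinner_minus_left)

lemma cinner_sum_left: "cinner (sum h I) v = (\<Sum>i\<in>I. cinner (h i) v)"
  by (induction I rule: infinite_finite_induct) (simp_all add: cinner_add_left)

lemma cinner_sum_right: "cinner v (sum h I) = (\<Sum>i\<in>I. cinner v (h i))"
  by (induction I rule: infinite_finite_induct) (simp_all add: cinner_add_right)


section \<open>Fields and normally ordered products\<close>

definition is_field :: "'h::complex_vector field_series \<Rightarrow> bool" where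
  "is_field A \<longleftrightarrow> (\<forall>k. clinear (A k)) \<and> (\<forall>v. \<forall>\<^sub>F k in at_top. A k v = 0)"

lemma is_field_linear: "is_field A \<Longrightarrow> clinear (A k)"
  by (simp add: is_field_def)

lemma is_field_eventually: "is_field A \<Longrightarrow> \<forall>\<^sub>F k in at_top. A k v = 0"
  by (simp add: is_field_def)

lemma eventually_at_top_int_shift:
  assumes "\<forall>\<^sub>F k in at_top. Q (k::int)"
  shows "\<forall>\<^sub>F k in at_top. Q (k + n)"
proof -
  obtain N where "\<And>k. k \<ge> N \<Longrightarrow> Q k"
    using assms by (auto simp: eventually_at_top_linorder)
  then show ?thesis
    by (auto simp: eventually_at_top_linorder intro!: exI[of _ "N - n"])
qed

lemma eventually_at_top_of_nat:
  assumes "\<forall>\<^sub>F k in at_top. Q (k::int)"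
  shows "\<forall>\<^sub>F p in sequentially. Q (n + int p)"
proof -
  obtain N where "\<And>k. k \<ge> N \<Longrightarrow> Q k"
    using assms by (auto simp: eventually_at_top_linorder)
  then show ?thesis
    by (auto simp: eventually_at_top_linorder intro!: exI[of _ "nat (N - n)"])
qed

lemma is_field_shift: "is_field A \<Longrightarrow> is_field (\<lambda>k. A (k + n))"
  unfolding is_field_def using eventually_at_top_int_shift by blast

lemma is_field_lincomb:
  assumes "finite I" "\<And>i. i \<in> I \<Longrightarrow> is_field (A i)"
  shows "is_field (\<lambda>k v. \<Sum>i\<in>I. q i *\<^sub>C A i k v)"
proof -
  have "\<forall>\<^sub>F k in at_top. (\<Sum>i\<in>I. q i *\<^sub>C A i k v) = 0" for v
  proof -
    have "\<forall>\<^sub>F k in at_top. \<forall>i\<in>I. A i k v = 0"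
      using assms by (intro eventually_ball_finite) (auto simp: is_field_def)
    then show ?thesis by eventually_elim simp
  qed
  then show ?thesis
    using assms(2) unfolding is_field_def by (auto intro!: clinear_lincomb)
qed

lemma is_field_add:
  assumes "is_field A" "is_field B"
  shows "is_field (\<lambda>k v. A k v + B k v)"
proof -
  have "\<forall>\<^sub>F k in at_top. A k v + B k v = 0" for v
    using is_field_eventually[OF assms(1), of v] is_field_eventually[OF assms(2), of v]
    by eventually_elim simp
  then show ?thesis
    using assms unfolding is_field_def by (auto intro!: clinear_plus)
qed

lemma is_field_scale:
  assumes "is_field A"
  shows "is_field (\<lambda>k v. c *\<^sub>C A k v)"
proof -
  have "\<forall>\<^sub>F k in at_top. c *\<^sub>C A k v = 0" for v
    using is_field_eventually[OF assms, of v] by eventually_elim simp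
  then show ?thesis
    using assms unfolding is_field_def by (auto intro!: clinear_scale)
qed

text \<open>The series c z^(-l-1) times the identity. Central terms of commutators are encoded as
  fields so that they can stand as factors of a normally ordered product.\<close>

definition delta_field :: "int \<Rightarrow> complex \<Rightarrow> 'h::complex_vector field_series" where
  "delta_field l c k v = (if k = l then c *\<^sub>C v else 0)"

lemma is_field_delta: "is_field (delta_field l c)"
  unfolding is_field_def delta_field_def eventually_at_top_dense
  by (auto intro!: clinearI exI[of _ l]
      simp: cvec.scale_right_distrib mult.commute)

lemma is_field_zero: "is_field (\<lambda>k v. 0)"
  unfolding is_field_def by (auto intro!: clinearI)

text \<open>The \<open>(-1)\<close>-st product with the sign factor decoupled from the parities of \<open>A\<close> and \<open>B\<close>:
  commuting an odd operator past one of the factors flips the sign.\<close>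

definition nop_term ::
  "complex \<Rightarrow> 'h::complex_vector field_series \<Rightarrow> 'h field_series \<Rightarrow> int \<Rightarrow> 'h \<Rightarrow> nat \<Rightarrow> 'h" where
  "nop_term s A B m v p =
     A (- 1 - int p) (B (m + int p) v) + s *\<^sub>C B (m - 1 - int p) (A (int p) v)"

definition nop ::
  "complex \<Rightarrow> 'h::complex_vector field_series \<Rightarrow> 'h field_series \<Rightarrow> 'h field_series" where
  "nop s A B m v = Sum_any (nop_term s A B m v)"

text \<open>At n = -1 the binomial coefficient is (p choose p) = 1, and the subtracted sign
  (-1)^(\<epsilon>-1) becomes an added (-1)^\<epsilon>.\<close>

lemma nth_product_minus_one: "nth_product \<epsilon> (- 1) A B = nop ((- 1) ^ \<epsilon>) A B"
proof -
  have "(- 1) powi (int \<epsilon> + - 1) = - ((- 1) ^ \<epsilon> :: complex)"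
    by (subst power_int_add) auto
  then show ?thesis
    by (intro ext) (simp add: nth_product_def nop_def nop_term_def[abs_def])
qed

text \<open>Stated for all large cut-offs, so that \<open>eventually_elim\<close> supplies one
  common cut-off whenever several normally ordered products are compared.\<close>

lemma nop_eventually:
  assumes A: "is_field A" and B: "is_field B"
  shows "\<forall>\<^sub>F P in sequentially. nop s A B m v = (\<Sum>p<P. nop_term s A B m v p)"
proof -
  have "\<forall>\<^sub>F p in sequentially. A (0 + int p) v = 0"
    using is_field_eventually[OF A] by (rule eventually_at_top_of_nat)
  moreover have "\<forall>\<^sub>F p in sequentially. B (m + int p) v = 0"
    using is_field_eventually[OF B] by (rule eventually_at_top_of_nat)
  ultimately have "\<forall>\<^sub>F p in sequentially. nop_term s A B m v p = 0"
    by eventually_elim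
      (simp add: nop_term_def clinear_zero[OF is_field_linear[OF A]]
        clinear_zero[OF is_field_linear[OF B]])
  then obtain P0 where P0: "\<And>p. p \<ge> P0 \<Longrightarrow> nop_term s A B m v p = 0"
    by (auto simp: eventually_sequentially)
  have "nop s A B m v = (\<Sum>p<P. nop_term s A B m v p)" if "P \<ge> P0" for P
    unfolding nop_def using P0 that
    by (intro Sum_any.expand_superset) (auto simp: not_le[symmetric])
  then show ?thesis by (auto simp: eventually_sequentially)
qed

lemma nop_lincomb_right:
  assumes "finite I" "is_field A" "\<And>i. i \<in> I \<Longrightarrow> is_field (B i)"
  shows "nop s A (\<lambda>k v. \<Sum>i\<in>I. q i *\<^sub>C B i k v) m v = (\<Sum>i\<in>I. q i *\<^sub>C nop s A (B i) m v)"
proof -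
  have "\<forall>\<^sub>F P in sequentially. \<forall>i\<in>I. nop s A (B i) m v = (\<Sum>p<P. nop_term s A (B i) m v p)"
    using assms by (intro eventually_ball_finite) (auto intro!: nop_eventually)
  moreover have "\<forall>\<^sub>F P in sequentially. nop s A (\<lambda>k v. \<Sum>i\<in>I. q i *\<^sub>C B i k v) m v =
      (\<Sum>p<P. nop_term s A (\<lambda>k v. \<Sum>i\<in>I. q i *\<^sub>C B i k v) m v p)"
    using assms by (intro nop_eventually is_field_lincomb) auto
  ultimately have "\<forall>\<^sub>F P in sequentially. ?thesis"
  proof eventually_elim
    case (elim P)
    have "nop_term s A (\<lambda>k v. \<Sum>i\<in>I. q i *\<^sub>C B i k v) m v p =
        (\<Sum>i\<in>I. q i *\<^sub>C nop_term s A (B i) m v p)" for p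
      by (simp add: nop_term_def clinear_sum[OF is_field_linear[OF assms(2)]]
          clinear_scaleC[OF is_field_linear[OF assms(2)]] cvec.scale_right_distrib sum.distrib
          cvec.scale_sum_right mult.commute)
    then show ?case
      using elim by (simp add: cvec.scale_sum_right sum.swap[of _ I])
  qed
  then show ?thesis by simp
qed

lemma nop_lincomb_left:
  assumes "finite I" "is_field B" "\<And>i. i \<in> I \<Longrightarrow> is_field (A i)"
  shows "nop s (\<lambda>k v. \<Sum>i\<in>I. q i *\<^sub>C A i k v) B m v = (\<Sum>i\<in>I. q i *\<^sub>C nop s (A i) B m v)"
proof -
  have "\<forall>\<^sub>F P in sequentially. \<forall>i\<in>I. nop s (A i) B m v = (\<Sum>p<P. nop_term s (A i) B m v p)"
    using assms by (intro eventually_ball_finite) (auto intro!: nop_eventually)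
  moreover have "\<forall>\<^sub>F P in sequentially. nop s (\<lambda>k v. \<Sum>i\<in>I. q i *\<^sub>C A i k v) B m v =
      (\<Sum>p<P. nop_term s (\<lambda>k v. \<Sum>i\<in>I. q i *\<^sub>C A i k v) B m v p)"
    using assms by (intro nop_eventually is_field_lincomb) auto
  ultimately have "\<forall>\<^sub>F P in sequentially. ?thesis"
  proof eventually_elim
    case (elim P)
    have "nop_term s (\<lambda>k v. \<Sum>i\<in>I. q i *\<^sub>C A i k v) B m v p =
        (\<Sum>i\<in>I. q i *\<^sub>C nop_term s (A i) B m v p)" for p
      by (simp add: nop_term_def clinear_sum[OF is_field_linear[OF assms(2)]]
          clinear_scaleC[OF is_field_linear[OF assms(2)]] cvec.scale_right_distrib sum.distrib
          cvec.scale_sum_right mult.commute)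
    then show ?case
      using elim by (simp add: cvec.scale_sum_right sum.swap[of _ I])
  qed
  then show ?thesis by simp
qed

lemma nop_add_right:
  assumes "is_field A" "is_field B" "is_field C"
  shows "nop s A (\<lambda>k v. B k v + C k v) m v = nop s A B m v + nop s A C m v"
  \<comment> \<open>A sum of two fields is a linear combination indexed by the Booleans.\<close>
  using nop_lincomb_right[of "{True, False}" A "\<lambda>b. if b then B else C" s "\<lambda>_. 1" m v] assms
  by (simp add: add.commute)

lemma nop_zero_right: "is_field A \<Longrightarrow> nop s A (\<lambda>k v. 0) m v = 0"
  by (simp add: nop_def nop_term_def[abs_def] clinear_zero[OF is_field_linear])

lemma nop_zero_left: "is_field B \<Longrightarrow> nop s (\<lambda>k v. 0) B m v = 0"
  by (simp add: nop_def nop_term_def[abs_def] clinear_zero[OF is_field_linear])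

lemma nop_delta_right:
  assumes "is_field A"
  shows "nop 1 A (delta_field l c) m v = c *\<^sub>C A (m - 1 - l) v"
proof -
  \<comment> \<open>Exactly one summand meets the mode l: through B(m - 1 - p) when l < m, through
    B(m + p) otherwise. With s = 1 both cases leave the same mode of A.\<close>
  define q where "q = (if l < m then nat (m - 1 - l) else nat (l - m))"
  have "nop 1 A (delta_field l c) m v = (\<Sum>p\<in>{q}. nop_term 1 A (delta_field l c) m v p)"
    unfolding nop_def
    by (rule Sum_any.expand_superset)
      (auto simp: nop_term_def delta_field_def q_def clinear_zero[OF is_field_linear[OF assms]]
        split: if_splits)
  also have "\<dots> = c *\<^sub>C A (m - 1 - l) v"
    by (auto simp: nop_term_def delta_field_def q_def clinear_zero[OF is_field_linear[OF assms]]
        clinear_scaleC[OF is_field_linear[OF assms]] algebra_simps)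
  finally show ?thesis .
qed

lemma nop_delta_left:
  assumes "is_field B"
  shows "nop 1 (delta_field l c) B m v = c *\<^sub>C B (m - 1 - l) v"
proof -
  define q where "q = (if l \<ge> 0 then nat l else nat (- 1 - l))"
  have "nop 1 (delta_field l c) B m v = (\<Sum>p\<in>{q}. nop_term 1 (delta_field l c) B m v p)"
    unfolding nop_def
    by (rule Sum_any.expand_superset)
      (auto simp: nop_term_def delta_field_def q_def clinear_zero[OF is_field_linear[OF assms]]
        split: if_splits)
  also have "\<dots> = c *\<^sub>C B (m - 1 - l) v"
    by (auto simp: nop_term_def delta_field_def q_def clinear_zero[OF is_field_linear[OF assms]]
        clinear_scaleC[OF is_field_linear[OF assms]] algebra_simps)
  finally show ?thesis .
qed

lemma nop_shift_right: "nop s A (\<lambda>k. B (k + n)) m v = nop s A B (m + n) v"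
  by (simp add: nop_def nop_term_def[abs_def] algebra_simps)

text \<open>Shifting the left factor moves finitely many terms across the normal ordering, each at the
  cost of a commutator.\<close>

lemma nop_shift_left:
  assumes A: "is_field A" and B: "is_field B"
    and comm: "\<And>j k. j + k = m + n - 1 \<Longrightarrow> A j (B k v) - s *\<^sub>C B k (A j v) = C"
  shows "nop s (\<lambda>k. A (k + n)) B m v = nop s A B (m + n) v + of_int n *\<^sub>C C"
proof -
  define M where "M = m + n"
  \<comment> \<open>Shifting the left factor by i while keeping the total mode M joins the two sides
    of the claim by unit steps. Each step moves one pair of modes across the ordering, always with j
    + k = M - 1, hence always at the same cost C.\<close>
  define N where "N i = nop s (\<lambda>k. A (k + i)) B (M - i) v" for i
  have step: "N (i + 1) = N i + C" for i
  proof -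
    define a where "a q = A (i - int q) (B (M - i - 1 + int q) v)" for q
    define b where "b q = s *\<^sub>C B (M - i - 1 - int q) (A (i + int q) v)" for q
    have 1: "nop_term s (\<lambda>k. A (k + i)) B (M - i) v p = a (Suc p) + b p" for p
      by (simp add: nop_term_def a_def b_def algebra_simps)
    have 2: "nop_term s (\<lambda>k. A (k + (i + 1))) B (M - (i + 1)) v p = a p + b (Suc p)" for p
      by (simp add: nop_term_def a_def b_def algebra_simps)
    have "\<forall>\<^sub>F P in sequentially. N i = (\<Sum>p<P. a (Suc p) + b p)"
      using nop_eventually[OF is_field_shift[OF A, of i] B, of s "M - i" v]
      by (simp add: 1 N_def)
    moreover have "\<forall>\<^sub>F P in sequentially. N (i + 1) = (\<Sum>p<P. a p + b (Suc p))"
      using nop_eventually[OF is_field_shift[OF A, of "i + 1"] B, of s "M - (i + 1)" v]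
      unfolding 2 N_def .
    moreover have "\<forall>\<^sub>F P in sequentially. A (i + int P) v = 0"
      using is_field_eventually[OF A] by (rule eventually_at_top_of_nat)
    moreover have "\<forall>\<^sub>F P in sequentially. B (M - i - 1 + int P) v = 0"
      using is_field_eventually[OF B] by (rule eventually_at_top_of_nat)
    ultimately have "\<forall>\<^sub>F P in sequentially. N (i + 1) - N i = C"
    proof eventually_elim
      case (elim P)
      \<comment> \<open>The difference of the partial sums telescopes. At the upper end both terms
        vanish on v; at the lower end the crossing pair remains as \<open>a 0 - b 0\<close>.\<close>
      have "N (i + 1) - N i = (\<Sum>p<P. b (Suc p) - b p) - (\<Sum>p<P. a (Suc p) - a p)"
        by (simp add: elim(1,2) flip: sum_subtractf) (simp add: algebra_simps)
      also have "\<dots> = (b P - b 0) - (a P - a 0)"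
        by (simp add: sum_lessThan_telescope)
      also have "\<dots> = a 0 - b 0"
        using elim(3,4)
        by (simp add: a_def b_def clinear_zero[OF is_field_linear[OF A]]
            clinear_zero[OF is_field_linear[OF B]])
      also have "\<dots> = C"
        unfolding a_def b_def using comm[of i "M - i - 1"] by (simp add: M_def)
      finally show ?case .
    qed
    then show ?thesis by (simp add: algebra_simps)
  qed
  have "N i = N 0 + of_int i *\<^sub>C C" for i
  proof (induction i rule: int_induct[of _ 0])
    case (step1 i)
    then show ?case by (simp add: step cvec.scale_left_distrib)
  next
    case (step2 i)
    then show ?case
      using step[of "i - 1"] by (simp add: cvec.scale_left_diff_distrib algebra_simps)
  qed simp
  from this[of n] show ?thesis by (simp add: N_def M_def)
qed

text \<open>\<alpha> and \<beta> are the signs for moving T past A and B. In the reversed term T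
  meets B first, so A' acquires \<beta> and B' acquires no sign; relative to the direct term this
  replaces s by \<beta> * s and, using \<alpha> * \<alpha> = 1, by \<alpha> * s.\<close>

lemma nop_commutator:
  assumes A: "is_field A" and B: "is_field B" and A': "is_field A'" and B': "is_field B'"
    and T: "clinear T" and \<alpha>: "\<alpha> * \<alpha> = 1"
    and TA: "\<And>k v. T (A k v) = \<alpha> *\<^sub>C A k (T v) + A' k v"
    and TB: "\<And>k v. T (B k v) = \<beta> *\<^sub>C B k (T v) + B' k v"
  shows "T (nop s A B m v) = (\<alpha> * \<beta>) *\<^sub>C nop s A B m (T v)
    + \<alpha> *\<^sub>C nop (\<alpha> * s) A B' m v + nop (\<beta> * s) A' B m v"
proof -
  note lin = clinear_add[OF is_field_linear[OF A]] clinear_scaleC[OF is_field_linear[OF A]]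
    clinear_add[OF is_field_linear[OF B]] clinear_scaleC[OF is_field_linear[OF B]]
    clinear_add[OF T] clinear_scaleC[OF T]
  have nop_term: "T (nop_term s A B m v p) = (\<alpha> * \<beta>) *\<^sub>C nop_term s A B m (T v) p
    + \<alpha> *\<^sub>C nop_term (\<alpha> * s) A B' m v p + nop_term (\<beta> * s) A' B m v p" for p
  proof -
    have "\<alpha> * (\<alpha> * s) = s" using \<alpha> by (simp flip: mult.assoc)
    then show ?thesis
      by (simp add: nop_term_def TA TB lin cvec.scale_right_distrib mult_ac add_ac)
  qed
  have "\<forall>\<^sub>F P in sequentially. nop s A B m v = (\<Sum>p<P. nop_term s A B m v p)"
    "\<forall>\<^sub>F P in sequentially. nop s A B m (T v) = (\<Sum>p<P. nop_term s A B m (T v) p)"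
    "\<forall>\<^sub>F P in sequentially. nop (\<alpha> * s) A B' m v = (\<Sum>p<P. nop_term (\<alpha> * s) A B' m v p)"
    "\<forall>\<^sub>F P in sequentially. nop (\<beta> * s) A' B m v = (\<Sum>p<P. nop_term (\<beta> * s) A' B m v p)"
    by (intro nop_eventually A B A' B')+
  then have "\<forall>\<^sub>F P in sequentially. ?thesis"
    by eventually_elim
      (simp add: clinear_sum[OF T] nop_term sum.distrib cvec.scale_sum_right)
  then show ?thesis by simp
qed

lemma is_field_nop:
  assumes A: "is_field A" and B: "is_field B"
  shows "is_field (nop s A B)"
proof -
  note lin = clinear_add[OF is_field_linear[OF A]] clinear_scaleC[OF is_field_linear[OF A]]
    clinear_add[OF is_field_linear[OF B]] clinear_scaleC[OF is_field_linear[OF B]]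
    clinear_zero[OF is_field_linear[OF A]] clinear_zero[OF is_field_linear[OF B]]
  have "clinear (nop s A B m)" for m
  proof (rule clinearI)
    fix u v
    have "\<forall>\<^sub>F P in sequentially. nop s A B m (u + v) = (\<Sum>p<P. nop_term s A B m (u + v) p)"
      "\<forall>\<^sub>F P in sequentially. nop s A B m u = (\<Sum>p<P. nop_term s A B m u p)"
      "\<forall>\<^sub>F P in sequentially. nop s A B m v = (\<Sum>p<P. nop_term s A B m v p)"
      by (intro nop_eventually A B)+
    then have "\<forall>\<^sub>F P in sequentially. nop s A B m (u + v) = nop s A B m u + nop s A B m v"
      by eventually_elim
        (simp add: nop_term_def lin cvec.scale_right_distrib add_ac flip: sum.distrib)
    then show "nop s A B m (u + v) = nop s A B m u + nop s A B m v" by simp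
  next
    fix c v
    have "\<forall>\<^sub>F P in sequentially. nop s A B m (c *\<^sub>C v) = (\<Sum>p<P. nop_term s A B m (c *\<^sub>C v) p)"
      "\<forall>\<^sub>F P in sequentially. nop s A B m v = (\<Sum>p<P. nop_term s A B m v p)"
      by (intro nop_eventually A B)+
    then have "\<forall>\<^sub>F P in sequentially. nop s A B m (c *\<^sub>C v) = c *\<^sub>C nop s A B m v"
      by eventually_elim
        (simp add: nop_term_def lin cvec.scale_right_distrib cvec.scale_sum_right mult_ac)
    then show "nop s A B m (c *\<^sub>C v) = c *\<^sub>C nop s A B m v" by simp
  qed
  moreover have "\<forall>\<^sub>F m in at_top. nop s A B m v = 0" for v
  proof -
    \<comment> \<open>Only the finitely many vectors A(p) v with p < P occur in the reversed terms,
      so a single bound on m makes B annihilate all of them.\<close>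
    obtain P where P: "\<And>p. p \<ge> P \<Longrightarrow> A (int p) v = 0"
      using eventually_at_top_of_nat[OF is_field_eventually[OF A], of 0 v]
      by (auto simp: eventually_sequentially)
    have "\<forall>\<^sub>F m in at_top. B (m + (- 1 - int p)) (A (int p) v) = 0" for p
      by (rule eventually_at_top_int_shift[OF is_field_eventually[OF B]])
    then have "\<forall>\<^sub>F m in at_top. \<forall>p\<in>{..<P}. B (m + (- 1 - int p)) (A (int p) v) = 0"
      by (intro eventually_ball_finite) auto
    moreover obtain M where "\<And>m. m \<ge> M \<Longrightarrow> B m v = 0"
      using is_field_eventually[OF B, of v] by (auto simp: eventually_at_top_linorder)
    then have "\<forall>\<^sub>F m in at_top. \<forall>p. B (m + int p) v = 0"
      by (auto simp: eventually_at_top_linorder intro!: exI[of _ M])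
    ultimately show ?thesis
    proof eventually_elim
      case (elim m)
      have "nop_term s A B m v p = 0" for p
      proof (cases "p < P")
        case True
        with elim show ?thesis by (simp add: nop_term_def lin algebra_simps)
      next
        case False
        with elim P show ?thesis by (simp add: nop_term_def lin)
      qed
      then show ?case by (simp add: nop_def)
    qed
  qed
  ultimately show ?thesis by (simp add: is_field_def)
qed


section \<open>Adjoint fields and locality\<close>

text \<open>The reflection k to -1 - k is the one natural for psi, whose k-th field mode is
  psi_(k+1/2); for other fields A' absorbs a shift. Such an A' makes the matrix coefficients of A
  vanish for very negative modes.\<close>

definition has_adjoint_field :: "'h::complex_inner field_series \<Rightarrow> bool" where
  "has_adjoint_field A \<longleftrightarrow>
     (\<exists>A'. is_field A' \<and> (\<forall>k u v. cinner (A k u) v = cinner u (A' (- 1 - k) v)))"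

lemma has_adjoint_field_lincomb:
  assumes "finite I" "\<And>i. i \<in> I \<Longrightarrow> has_adjoint_field (A i)"
  shows "has_adjoint_field (\<lambda>k v. \<Sum>i\<in>I. q i *\<^sub>C A i k v)"
proof -
  obtain A' where A': "\<And>i. i \<in> I \<Longrightarrow> is_field (A' i)"
    "\<And>i k u v. i \<in> I \<Longrightarrow> cinner (A i k u) v = cinner u (A' i (- 1 - k) v)"
    using assms(2) unfolding has_adjoint_field_def by metis
  then show ?thesis
    unfolding has_adjoint_field_def
    using is_field_lincomb[OF assms(1), of A' "\<lambda>i. cnj (q i)"]
    by (intro exI[of _ "\<lambda>k v. \<Sum>i\<in>I. cnj (q i) *\<^sub>C A' i k v"])
      (auto simp: cinner_sum_left cinner_sum_right cinner_scaleC_left cinner_scaleC_right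
        intro!: sum.cong)
qed

lemma has_adjoint_field_add:
  assumes "has_adjoint_field A" "has_adjoint_field B"
  shows "has_adjoint_field (\<lambda>k v. A k v + B k v)"
  using has_adjoint_field_lincomb[of "{True, False}" "\<lambda>b. if b then A else B" "\<lambda>_. 1"] assms
  by (simp add: add.commute)

lemma has_adjoint_field_scale:
  assumes "has_adjoint_field A"
  shows "has_adjoint_field (\<lambda>k v. c *\<^sub>C A k v)"
  using has_adjoint_field_lincomb[of "{()}" "\<lambda>_. A" "\<lambda>_. c"] assms by simp

text \<open>Taking adjoints reverses the order and so exchanges the two summands of
  \<open>nop_term\<close>. Because s is real with square 1, this amounts to an overall factor
  s.\<close>

lemma has_adjoint_field_nop:
  assumes A: "is_field A" "has_adjoint_field A" and B: "is_field B" "has_adjoint_field B"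
    and s: "s * s = 1" "cnj s = s"
  shows "has_adjoint_field (nop s A B)"
proof -
  obtain A' where A': "is_field A'" "\<And>k u v. cinner (A k u) v = cinner u (A' (- 1 - k) v)"
    using A(2) unfolding has_adjoint_field_def by blast
  obtain B' where B': "is_field B'" "\<And>k u v. cinner (B k u) v = cinner u (B' (- 1 - k) v)"
    using B(2) unfolding has_adjoint_field_def by blast
  define C where "C m v = s *\<^sub>C nop s A' B' (m + 1) v" for m v
  have "is_field C"
    unfolding C_def by (intro is_field_scale is_field_shift is_field_nop A' B')
  moreover have "cinner (nop s A B m u) v = cinner u (C (- 1 - m) v)" for m u v
  proof -
    have "\<forall>\<^sub>F P in sequentially. nop s A B m u = (\<Sum>p<P. nop_term s A B m u p)"
      "\<forall>\<^sub>F P in sequentially. nop s A' B' (- m) v = (\<Sum>p<P. nop_term s A' B' (- m) v p)"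
      by (intro nop_eventually A B A' B')+
    then have "\<forall>\<^sub>F P in sequentially. cinner (nop s A B m u) v = cinner u (C (- 1 - m) v)"
    proof eventually_elim
      case (elim P)
      have "cinner (nop_term s A B m u p) v = cinner u (s *\<^sub>C nop_term s A' B' (- m) v p)" for p
      proof -
        have "B' (- 1 - (m + int p)) = B' (- m - 1 - int p)"
          by (rule arg_cong[of _ _ B']) simp
        then show ?thesis
          using s by (simp add: nop_term_def cinner_add_left cinner_add_right cinner_scaleC_left
              cinner_scaleC_right A'(2) B'(2) cvec.scale_right_distrib distrib_left
              flip: mult.assoc)
      qed
      then show ?case
        by (simp add: elim C_def cinner_sum_left cinner_sum_right cvec.scale_sum_right)
    qed
    then show ?thesis by simp
  qed
  ultimately show ?thesis unfolding has_adjoint_field_def by blast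
qed

section \<open>Inverting multiplication by (z - w)^2\<close>

lemma sum_second_difference:
  fixes f :: "nat \<Rightarrow> complex"
  shows "(\<Sum>k<n. of_nat (k + 1) * (f k - 2 * f (k + 1) + f (k + 2))) =
    f 0 - of_nat (n + 1) * f n + of_nat n * f (n + 1)"
  by (induction n) (simp_all add: algebra_simps)

text \<open>The weights (2 + k - 1 choose k) = k + 1 are the coefficients of (1 - x)^(-2), which
  undoes the second difference; the boundary terms vanish because f does.\<close>

lemma Sum_any_second_difference:
  fixes f :: "nat \<Rightarrow> complex"
  assumes "\<And>k. k \<ge> n \<Longrightarrow> f k = 0"
  shows "Sum_any (\<lambda>k. of_nat (2 + k - 1 choose k) * (f k - 2 * f (k + 1) + f (k + 2))) = f 0"
proof -
  have "(2 + k - 1) choose k = k + 1" for k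
    using binomial_Suc_n[of k] by simp
  then have "Sum_any (\<lambda>k. of_nat (2 + k - 1 choose k) * (f k - 2 * f (k + 1) + f (k + 2))) =
      Sum_any (\<lambda>k. of_nat (k + 1) * (f k - 2 * f (k + 1) + f (k + 2)))"
    by presburger
  also have "\<dots> = (\<Sum>k<n. of_nat (k + 1) * (f k - 2 * f (k + 1) + f (k + 2)))"
    using assms by (intro Sum_any.expand_superset) (auto simp: not_le[symmetric])
  also have "\<dots> = f 0"
    unfolding sum_second_difference using assms by simp
  finally show ?thesis .
qed

text \<open>B k annihilates u for large k, and the adjoint of A j annihilates v for very negative j.
  Each bound is uniform in the other index, which is what later gives a finite support.\<close>

lemma field_matrix_coefficient_bounds:
  assumes "is_field B" "has_adjoint_field A" "\<And>k. clinear (A k)"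
  obtains N :: int where "\<And>j k. k \<ge> N \<Longrightarrow> cinner (A j (B k u)) v = 0"
    "\<And>j k. j \<le> - N \<Longrightarrow> cinner (A j (B k u)) v = 0"
proof -
  obtain A' where A': "is_field A'" "\<And>k u v. cinner (A k u) v = cinner u (A' (- 1 - k) v)"
    using assms(2) unfolding has_adjoint_field_def by blast
  obtain N1 where N1: "\<And>k. k \<ge> N1 \<Longrightarrow> B k u = 0"
    using is_field_eventually[OF assms(1)] by (auto simp: eventually_at_top_linorder)
  obtain N2 where N2: "\<And>k. k \<ge> N2 \<Longrightarrow> A' k v = 0"
    using is_field_eventually[OF A'(1)] by (auto simp: eventually_at_top_linorder)
  show ?thesis
    by (rule that[of "max N1 (N2 + 1)"]) (simp_all add: N1 N2 A'(2) clinear_zero[OF assms(3)])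
qed

text \<open>The second difference of the commutator is its product with \<open>(z - w)\<^sup>2\<close>. The two orderings
  bound the support of the resulting common matrix coefficient from opposite sides.\<close>

lemma mutually_localI:
  assumes A: "is_field A" "has_adjoint_field A" and B: "is_field B" "has_adjoint_field B"
    and comm: "\<And>m n v. super_commutator \<epsilon> (A (m + 2)) (B n) v
      - 2 *\<^sub>C super_commutator \<epsilon> (A (m + 1)) (B (n + 1)) v
      + super_commutator \<epsilon> (A m) (B (n + 2)) v = 0"
  shows "mutually_local \<epsilon> A B"
  unfolding mutually_local_def
proof (intro exI[of _ "2::nat"] allI)
  fix u v
  define f where "f i j = cinner (A (- i - 1) (B (- j - 1) u)) v" for i j
  define h where "h i j = (- 1) ^ \<epsilon> * cinner (B (- j - 1) (A (- i - 1) u)) v" for i j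
  \<comment> \<open>The coefficients of (z - w)^2 A(z) B(w); \<open>Ph\<close> shows that the
    opposite ordering yields the same ones.\<close>
  define P where "P i j = f (i - 2) j - 2 * f (i - 1) (j - 1) + f i (j - 2)" for i j
  obtain N1 where N1: "\<And>j k. k \<ge> N1 \<Longrightarrow> cinner (A j (B k u)) v = 0"
    "\<And>j k. j \<le> - N1 \<Longrightarrow> cinner (A j (B k u)) v = 0"
    using field_matrix_coefficient_bounds[OF B(1) A(2) is_field_linear[OF A(1)]] by metis
  obtain N2 where N2: "\<And>j k. k \<ge> N2 \<Longrightarrow> cinner (B j (A k u)) v = 0"
    "\<And>j k. j \<le> - N2 \<Longrightarrow> cinner (B j (A k u)) v = 0"
    using field_matrix_coefficient_bounds[OF A(1) B(2) is_field_linear[OF B(1)]] by metis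
  have f0: "f i j = 0" if "j \<le> - N1 - 1 \<or> i \<ge> N1 - 1" for i j
    using that N1 by (auto simp: f_def)
  have h0: "h i j = 0" if "i \<le> - N2 - 1 \<or> j \<ge> N2 - 1" for i j
    using that N2 by (auto simp: h_def)
  have Ph: "P i j = h (i - 2) j - 2 * h (i - 1) (j - 1) + h i (j - 2)" for i j
  proof -
    have fh: "f i j - h i j = cinner (super_commutator \<epsilon> (A (- i - 1)) (B (- j - 1)) u) v" for i j
      by (simp add: f_def h_def super_commutator_def cinner_diff_left cinner_scaleC_left)
    have "(f (i - 2) j - h (i - 2) j) - 2 * (f (i - 1) (j - 1) - h (i - 1) (j - 1))
        + (f i (j - 2) - h i (j - 2)) =
      cinner (super_commutator \<epsilon> (A (- i - 1 + 2)) (B (- j - 1)) u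
      - 2 *\<^sub>C super_commutator \<epsilon> (A (- i - 1 + 1)) (B (- j - 1 + 1)) u
      + super_commutator \<epsilon> (A (- i - 1)) (B (- j - 1 + 2)) u) v"
      by (simp add: fh cinner_diff_left cinner_add_left cinner_scaleC_left)
    also have "\<dots> = 0" by (simp only: comm cinner_zero_left)
    finally show ?thesis by (simp add: P_def algebra_simps)
  qed
  \<comment> \<open>From f come the bounds i from above and j from below, from h the bounds i from
    below and j from above: together a finite box.\<close>
  have "{(i, j). P i j \<noteq> 0} \<subseteq> {- N2 - 1..N1 + 1} \<times> {- N1 - 1..N2 + 1}"
  proof clarify
    fix i j assume nz: "P i j \<noteq> 0"
    have "j > - N1 - 1" "i < N1 + 1"
      using nz f0 unfolding P_def by (smt (verit) diff_zero mult_zero_right add_0)+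
    moreover have "i > - N2 - 1" "j < N2 + 1"
      using nz h0 unfolding Ph by (smt (verit) diff_zero mult_zero_right add_0)+
    ultimately show "i \<in> {- N2 - 1..N1 + 1} \<and> j \<in> {- N1 - 1..N2 + 1}" by auto
  qed
  then have fin: "finite {(i, j). P i j \<noteq> 0}"
    by (rule finite_subset) auto
  \<comment> \<open>Along the line of pairs (i + k, j - k) the coefficients of P are second
    differences of f, so the expansion sums back to the value at k = 0. For h the line runs the
    other way.\<close>
  have f_eq: "f i j = expand_z_gt_w 2 P i j" for i j
  proof -
    have "f (i + int k) (j - int k) = 0" if "k \<ge> nat (N1 + 1 + j)" for k
      using that by (intro f0) auto
    note Sum_any_second_difference[of "nat (N1 + 1 + j)" "\<lambda>k. f (i + int k) (j - int k)", OF this]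
    then show ?thesis
      by (simp add: expand_z_gt_w_def P_def algebra_simps)
  qed
  have h_eq: "h i j = expand_w_gt_z 2 P i j" for i j
  proof -
    have "h (i - int k) (j + int k) = 0" if "k \<ge> nat (N2 + 1 + i)" for k
      using that by (intro h0) auto
    note Sum_any_second_difference[of "nat (N2 + 1 + i)" "\<lambda>k. h (i - int k) (j + int k)", OF this]
    then show ?thesis
      by (simp add: expand_w_gt_z_def Ph algebra_simps)
  qed
  show "\<exists>P. finite {(i, j). P i j \<noteq> 0} \<and>
      (\<forall>m n. cinner (A m (B n u)) v = expand_z_gt_w 2 P (- m - 1) (- n - 1) \<and>
             (- 1) ^ \<epsilon> * cinner (B n (A m u)) v = expand_w_gt_z 2 P (- m - 1) (- n - 1))"
    by (intro exI[of _ P] conjI allI fin) (simp_all add: f_def h_def flip: f_eq h_eq)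
qed


section \<open>Commutation relations of the model\<close>

text \<open>The interface between the representations and the computation. Fermions are indexed by
  field modes, which turns the condition m + n = 0 of the anticommutator into m + n = -1.\<close>

locale susy_modes =
  fixes \<Gamma> :: "'i::finite \<Rightarrow> 'i \<Rightarrow> 'i \<Rightarrow> real"
    and level g :: nat
    and X :: "'i \<Rightarrow> int \<Rightarrow> 'h::complex_inner \<Rightarrow> 'h"
    and \<psi> :: "'i \<Rightarrow> rat \<Rightarrow> 'h \<Rightarrow> 'h"
  assumes antisym12: "\<Gamma> a b c = - \<Gamma> b a c"
    and antisym23: "\<Gamma> a b c = - \<Gamma> a c b"
    and jacobi: "(\<Sum>e\<in>UNIV. \<Gamma> b c e * \<Gamma> a e f + \<Gamma> c a e * \<Gamma> b e f + \<Gamma> a b e * \<Gamma> c e f) = 0"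
    and casimir: "(\<Sum>b\<in>UNIV. \<Sum>c\<in>UNIV. \<Gamma> a b c * \<Gamma> e b c) = (if a = e then 2 * real g else 0)"
    and X_field: "is_field (X a)"
    and psi_field: "is_field (psi_field \<psi> a)"
    and X_adjoint: "has_adjoint_field (X a)"
    and psi_adjoint: "has_adjoint_field (psi_field \<psi> a)"
    and X_X: "X a m (X b n v) = X b n (X a m v) +
      (\<Sum>c\<in>UNIV. (\<i> * of_real (\<Gamma> a b c)) *\<^sub>C X c (m + n) v) +
      (if a = b \<and> m + n = 0 then (of_int m * of_nat level) *\<^sub>C v else 0)"
    and psi_psi: "psi_field \<psi> a m (psi_field \<psi> b n v) =
      - psi_field \<psi> b n (psi_field \<psi> a m v) + (if a = b \<and> m + n = - 1 then v else 0)"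
    and X_psi: "X a m (psi_field \<psi> b n v) = psi_field \<psi> b n (X a m v)"
begin

abbreviation \<Psi> where "\<Psi> \<equiv> psi_field \<psi>"
abbreviation S where "S \<equiv> S_field \<Gamma> \<psi>"
abbreviation B where "B \<equiv> B_field \<Gamma> X \<psi>"

lemma cyclic: "\<Gamma> a b c = \<Gamma> b c a"
  using antisym12[of a b c] antisym23[of b a c] by simp

section \<open>The fermion bilinears S^c\<close>

lemma S_eq: "S c n v =
    (\<Sum>a\<in>UNIV. \<Sum>b\<in>UNIV. (- \<i> / 2 * \<Gamma> a b c) *\<^sub>C nop (- 1) (\<Psi> a) (\<Psi> b) n v)"
  by (simp add: S_field_def nth_product_minus_one cvec.scale_sum_right)

text \<open>The double sum is flattened to one sum over pairs, the shape to which the closure rules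
  for linear combinations apply.\<close>

lemma S_eq_pairs: "S c = (\<lambda>n v. \<Sum>i\<in>UNIV. (- \<i> / 2 * \<Gamma> (fst i) (snd i) c) *\<^sub>C
    nop (- 1) (\<Psi> (fst i)) (\<Psi> (snd i)) n v)"
  unfolding S_eq[abs_def]
  by (simp add: sum.cartesian_product case_prod_beta flip: UNIV_Times_UNIV)

lemma S_field: "is_field (S c)"
  unfolding S_eq_pairs by (intro is_field_lincomb is_field_nop psi_field finite)

lemma S_adjoint: "has_adjoint_field (S c)"
  unfolding S_eq_pairs
  by (intro has_adjoint_field_lincomb has_adjoint_field_nop psi_field psi_adjoint finite) auto

lemma B_eq: "B a = (\<lambda>n v. X a n v + S a n v)"
  by (intro ext) (simp add: B_field_def)

lemma B_is_field: "is_field (B a)"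
  unfolding B_eq by (intro is_field_add X_field S_field)

lemma B_adjoint: "has_adjoint_field (B a)"
  unfolding B_eq by (intro has_adjoint_field_add X_adjoint S_adjoint)

lemma psi_psi_delta: "\<Psi> e n (\<Psi> a k v) =
    (- 1) *\<^sub>C \<Psi> a k (\<Psi> e n v) + delta_field (- 1 - n) (if e = a then 1 else 0) k v"
  using psi_psi[of e n a k v] by (auto simp: delta_field_def)

text \<open>psi^e contracts with either factor of psi^a psi^b, with opposite signs. Antisymmetry of
  \<Gamma> makes the two contributions equal, and together they cancel the 1/2 in S. Hence S acts on
  the fermions by the adjoint representation.\<close>

lemma psi_S: "\<Psi> e n (S c m v) =
    S c m (\<Psi> e n v) + (\<Sum>a\<in>UNIV. (- \<i> * \<Gamma> c e a) *\<^sub>C \<Psi> a (m + n) v)"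
proof -
  have nop: "\<Psi> e n (nop (- 1) (\<Psi> a) (\<Psi> b) m v) = nop (- 1) (\<Psi> a) (\<Psi> b) m (\<Psi> e n v)
      + ((if e = a then \<Psi> b (m + n) v else 0) - (if e = b then \<Psi> a (m + n) v else 0))" for a b
    using nop_commutator[where T = "\<Psi> e n" and A = "\<Psi> a" and B = "\<Psi> b" and \<alpha> = "- 1"
        and \<beta> = "- 1" and s = "- 1" and m = m and v = v,
        OF psi_field psi_field is_field_delta is_field_delta is_field_linear[OF psi_field]
          _ psi_psi_delta psi_psi_delta]
    by (simp add: nop_delta_left nop_delta_right psi_field)
  have coeff: "- \<i> / 2 * \<Gamma> e b c - - \<i> / 2 * \<Gamma> b e c = - \<i> * \<Gamma> c e b" for b
    using antisym12[of b e c] cyclic[of c b e] antisym23[of c b e] cyclic[of b e c]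
    by simp
  have "\<Psi> e n (S c m v) = S c m (\<Psi> e n v) +
      ((\<Sum>b\<in>UNIV. (- \<i> / 2 * \<Gamma> e b c) *\<^sub>C \<Psi> b (m + n) v)
      - (\<Sum>a\<in>UNIV. (- \<i> / 2 * \<Gamma> a e c) *\<^sub>C \<Psi> a (m + n) v))"
  proof -
    have "(\<Sum>a\<in>UNIV. \<Sum>b\<in>UNIV. (- \<i> / 2 * \<Gamma> a b c) *\<^sub>C (if e = a then \<Psi> b (m + n) v else 0)) =
        (\<Sum>b\<in>UNIV. (- \<i> / 2 * \<Gamma> e b c) *\<^sub>C \<Psi> b (m + n) v)"
      by (subst sum.swap) (simp only: sum_if_scaleC)
    moreover have "(\<Sum>a\<in>UNIV. \<Sum>b\<in>UNIV. (- \<i> / 2 * \<Gamma> a b c) *\<^sub>C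
        (if e = b then \<Psi> a (m + n) v else 0)) =
        (\<Sum>a\<in>UNIV. (- \<i> / 2 * \<Gamma> a e c) *\<^sub>C \<Psi> a (m + n) v)"
      by (simp only: sum_if_scaleC)
    ultimately show ?thesis
      unfolding S_eq clinear_sum[OF is_field_linear[OF psi_field]]
        clinear_scaleC[OF is_field_linear[OF psi_field]] nop cvec.scale_right_distrib
        cvec.scale_right_diff_distrib sum.distrib sum_subtractf
      by simp
  qed
  also have "(\<Sum>b\<in>UNIV. (- \<i> / 2 * \<Gamma> e b c) *\<^sub>C \<Psi> b (m + n) v)
      - (\<Sum>a\<in>UNIV. (- \<i> / 2 * \<Gamma> a e c) *\<^sub>C \<Psi> a (m + n) v) =
      (\<Sum>a\<in>UNIV. (- \<i> * \<Gamma> c e a) *\<^sub>C \<Psi> a (m + n) v)"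
    unfolding sum_subtractf[symmetric] cvec.scale_left_diff_distrib[symmetric] coeff ..
  finally show ?thesis .
qed

lemma S_psi: "S c m (\<Psi> e n v) =
    \<Psi> e n (S c m v) + (\<Sum>a\<in>UNIV. (\<i> * \<Gamma> c e a) *\<^sub>C \<Psi> a (n + m) v)"
  unfolding psi_S by (simp add: add.commute sum_negf)

lemma X_S: "X a n (S c m v) = S c m (X a n v)"
proof -
  have "X a n (nop (- 1) (\<Psi> b) (\<Psi> e) m v) = nop (- 1) (\<Psi> b) (\<Psi> e) m (X a n v)" for b e
    using nop_commutator[where T = "X a n" and A = "\<Psi> b" and B = "\<Psi> e" and \<alpha> = 1
        and \<beta> = 1 and s = "- 1" and m = m and v = v,
        OF psi_field psi_field is_field_zero is_field_zero is_field_linear[OF X_field]] X_psi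
    by (simp add: nop_zero_left nop_zero_right psi_field)
  then show ?thesis
    unfolding S_eq clinear_sum[OF is_field_linear[OF X_field]]
      clinear_scaleC[OF is_field_linear[OF X_field]] by simp
qed

text \<open>Common to [S, S] and [B, psi Y]: an even operator T rotates both families by the adjoint
  representation and raises modes by n. Raising the mode of the right factor merely relabels the
  product, while raising that of the left factor costs n times the commutator C. Central terms D
  arise from Z only.\<close>

lemma structure_commutator_nop:
  fixes Y Z :: "'i \<Rightarrow> 'h field_series"
  assumes Y: "\<And>b. is_field (Y b)" and Z: "\<And>b. is_field (Z b)" and D: "is_field D"
    and T: "clinear T"
    and TY: "\<And>k v. T (Y c k v) = Y c k (T v) + (\<Sum>e\<in>UNIV. (\<i> * \<Gamma> a c e) *\<^sub>C Y e (k + n) v)"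
    and TZ: "\<And>k v. T (Z b k v) =
      Z b k (T v) + ((\<Sum>e\<in>UNIV. (\<i> * \<Gamma> a b e) *\<^sub>C Z e (k + n) v) + D k v)"
    and YZ: "\<And>e j k. j + k = m + n - 1 \<Longrightarrow> Y e j (Z b k v) - s *\<^sub>C Z b k (Y e j v) = C e"
  shows "T (nop s (Y c) (Z b) m v) = nop s (Y c) (Z b) m (T v)
    + ((\<Sum>e\<in>UNIV. (\<i> * \<Gamma> a b e) *\<^sub>C nop s (Y c) (Z e) (m + n) v)
      + (\<Sum>e\<in>UNIV. (\<i> * \<Gamma> a c e) *\<^sub>C nop s (Y e) (Z b) (m + n) v)
      + (\<Sum>e\<in>UNIV. (\<i> * \<Gamma> a c e * of_int n) *\<^sub>C C e)
      + nop s (Y c) D m v)"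
proof -
  let ?Y = "\<lambda>k v. \<Sum>e\<in>UNIV. (\<i> * \<Gamma> a c e) *\<^sub>C Y e (k + n) v"
  let ?Z = "\<lambda>k v. \<Sum>e\<in>UNIV. (\<i> * \<Gamma> a b e) *\<^sub>C Z e (k + n) v"
  have fields: "is_field ?Y" "is_field ?Z"
    by (intro is_field_lincomb is_field_shift Y Z finite)+
  have "T (nop s (Y c) (Z b) m v) = nop s (Y c) (Z b) m (T v)
      + nop s (Y c) (\<lambda>k v. ?Z k v + D k v) m v + nop s ?Y (Z b) m v"
    using nop_commutator[where \<alpha> = 1 and \<beta> = 1 and s = s and m = m and v = v,
        OF Y[of c] Z[of b] fields(1) is_field_add[OF fields(2) D] T] TY TZ
    by simp
  also have "nop s (Y c) (\<lambda>k v. ?Z k v + D k v) m v =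
      (\<Sum>e\<in>UNIV. (\<i> * \<Gamma> a b e) *\<^sub>C nop s (Y c) (Z e) (m + n) v) + nop s (Y c) D m v"
    by (simp add: nop_add_right Y Z D fields nop_lincomb_right is_field_shift nop_shift_right)
  also have "nop s ?Y (Z b) m v =
      (\<Sum>e\<in>UNIV. (\<i> * \<Gamma> a c e) *\<^sub>C nop s (Y e) (Z b) (m + n) v)
      + (\<Sum>e\<in>UNIV. (\<i> * \<Gamma> a c e * of_int n) *\<^sub>C C e)"
    by (simp add: nop_lincomb_left Z Y is_field_shift nop_shift_left[OF Y Z YZ]
        cvec.scale_right_distrib sum.distrib)
  finally show ?thesis by (simp add: add_ac)
qed

text \<open>The S^a satisfy the affine relations at level g. The central term comes from fermions
  crossing the normal ordering.\<close>

lemma S_S: "S a n (S b m v) = S b m (S a n v)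
    + ((\<Sum>c\<in>UNIV. (\<i> * \<Gamma> a b c) *\<^sub>C S c (m + n) v)
      + delta_field (- n) (if a = b then of_int n * of_nat g else 0) m v)"
proof -
  define N where "N c d = nop (- 1) (\<Psi> c) (\<Psi> d) (m + n) v" for c d
  \<comment> \<open>Crossing pairs have j + k = m + n - 1, so they contract exactly when m + n =
    0.\<close>
  define w where "w = (if m + n = 0 then v else 0)"
  have YZ: "\<Psi> e j (\<Psi> d k v) - (- 1) *\<^sub>C \<Psi> d k (\<Psi> e j v) = (if e = d then w else 0)"
    if "j + k = m + n - 1" for d e j k
  proof -
    have "j + k = - 1 \<longleftrightarrow> m + n = 0" using that by auto
    then show ?thesis using psi_psi[of e j d k v] by (simp add: w_def)
  qed
  have nop: "S a n (nop (- 1) (\<Psi> c) (\<Psi> d) m v) = nop (- 1) (\<Psi> c) (\<Psi> d) m (S a n v)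
      + ((\<Sum>e\<in>UNIV. (\<i> * \<Gamma> a d e) *\<^sub>C N c e) + (\<Sum>e\<in>UNIV. (\<i> * \<Gamma> a c e) *\<^sub>C N e d)
      + (\<Sum>e\<in>UNIV. (\<i> * \<Gamma> a c e * of_int n) *\<^sub>C (if e = d then w else 0)))" for c d
    unfolding N_def
    using structure_commutator_nop[where T = "S a n" and Y = \<Psi> and Z = \<Psi> and a = a and n = n
        and b = d and c = c and m = m and v = v and C = "\<lambda>e. if e = d then w else 0",
        OF psi_field psi_field is_field_zero is_field_linear[OF S_field] S_psi _ YZ]
    by (simp add: S_psi nop_zero_right psi_field)
  have S_nop: "S a n (S b m v) = S b m (S a n v) +
      ((\<Sum>c\<in>UNIV. \<Sum>d\<in>UNIV. (- \<i> / 2 * \<Gamma> c d b) *\<^sub>C (\<Sum>e\<in>UNIV. (\<i> * \<Gamma> a d e) *\<^sub>C N c e))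
      + (\<Sum>c\<in>UNIV. \<Sum>d\<in>UNIV. (- \<i> / 2 * \<Gamma> c d b) *\<^sub>C (\<Sum>e\<in>UNIV. (\<i> * \<Gamma> a c e) *\<^sub>C N e d))
      + (\<Sum>c\<in>UNIV. \<Sum>d\<in>UNIV. (- \<i> / 2 * \<Gamma> c d b) *\<^sub>C (\<i> * \<Gamma> a c d * of_int n) *\<^sub>C w))"
    unfolding S_eq[of b] clinear_sum[OF is_field_linear[OF S_field]]
      clinear_scaleC[OF is_field_linear[OF S_field]] nop sum_if_scaleC cvec.scale_right_distrib
      sum.distrib ..
  \<comment> \<open>\<open>1\<close>, \<open>2\<close> and \<open>3\<close> bring all bilinear terms
    to the form of a sum over p, q of a coefficient times \<open>N p q\<close>, so that an identity
    of coefficients suffices.\<close>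
  have 1: "(\<Sum>c\<in>UNIV. \<Sum>d\<in>UNIV. (- \<i> / 2 * \<Gamma> c d b) *\<^sub>C (\<Sum>e\<in>UNIV. (\<i> * \<Gamma> a d e) *\<^sub>C N c e)) =
      (\<Sum>p\<in>UNIV. \<Sum>q\<in>UNIV. of_real (1 / 2 * (\<Sum>r\<in>UNIV. \<Gamma> p r b * \<Gamma> a r q)) *\<^sub>C N p q)"
  proof (rule sum.cong[OF refl])
    fix c
    have "(\<Sum>d\<in>UNIV. (- \<i> / 2 * \<Gamma> c d b) *\<^sub>C (\<Sum>e\<in>UNIV. (\<i> * \<Gamma> a d e) *\<^sub>C N c e)) =
      (\<Sum>d\<in>UNIV. \<Sum>e\<in>UNIV. of_real (1 / 2 * (\<Gamma> c d b * \<Gamma> a d e)) *\<^sub>C N c e)"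
      by (simp add: cvec.scale_sum_right mult_ac)
    also have "\<dots> = (\<Sum>e\<in>UNIV. \<Sum>d\<in>UNIV. of_real (1 / 2 * (\<Gamma> c d b * \<Gamma> a d e)) *\<^sub>C N c e)"
      by (rule sum.swap)
    finally show "(\<Sum>d\<in>UNIV. (- \<i> / 2 * \<Gamma> c d b) *\<^sub>C (\<Sum>e\<in>UNIV. (\<i> * \<Gamma> a d e) *\<^sub>C N c e)) =
      (\<Sum>q\<in>UNIV. of_real (1 / 2 * (\<Sum>r\<in>UNIV. \<Gamma> c r b * \<Gamma> a r q)) *\<^sub>C N c q)"
      by (simp only: cvec.scale_sum_left[symmetric] sum_distrib_left of_real_sum)
  qed
  have 2: "(\<Sum>c\<in>UNIV. \<Sum>d\<in>UNIV. (- \<i> / 2 * \<Gamma> c d b) *\<^sub>C (\<Sum>e\<in>UNIV. (\<i> * \<Gamma> a c e) *\<^sub>C N e d)) =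
      (\<Sum>p\<in>UNIV. \<Sum>q\<in>UNIV. of_real (1 / 2 * (\<Sum>r\<in>UNIV. \<Gamma> r q b * \<Gamma> a r p)) *\<^sub>C N p q)"
  proof -
    have "(\<Sum>c\<in>UNIV. \<Sum>d\<in>UNIV. (- \<i> / 2 * \<Gamma> c d b) *\<^sub>C (\<Sum>e\<in>UNIV. (\<i> * \<Gamma> a c e) *\<^sub>C N e d)) =
      (\<Sum>c\<in>UNIV. \<Sum>d\<in>UNIV. \<Sum>e\<in>UNIV. of_real (1 / 2 * (\<Gamma> c d b * \<Gamma> a c e)) *\<^sub>C N e d)"
      by (simp add: cvec.scale_sum_right mult_ac)
    also have "\<dots> = (\<Sum>d\<in>UNIV. \<Sum>c\<in>UNIV. \<Sum>e\<in>UNIV.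
        of_real (1 / 2 * (\<Gamma> c d b * \<Gamma> a c e)) *\<^sub>C N e d)"
      by (rule sum.swap)
    also have "\<dots> = (\<Sum>d\<in>UNIV. \<Sum>e\<in>UNIV. \<Sum>c\<in>UNIV.
        of_real (1 / 2 * (\<Gamma> c d b * \<Gamma> a c e)) *\<^sub>C N e d)"
      by (intro sum.cong refl sum.swap)
    also have "\<dots> = (\<Sum>e\<in>UNIV. \<Sum>d\<in>UNIV. \<Sum>c\<in>UNIV.
        of_real (1 / 2 * (\<Gamma> c d b * \<Gamma> a c e)) *\<^sub>C N e d)"
      by (rule sum.swap)
    finally show ?thesis
      by (simp only: cvec.scale_sum_left[symmetric] sum_distrib_left of_real_sum)
  qed
  have 3: "(\<Sum>c\<in>UNIV. (\<i> * \<Gamma> a b c) *\<^sub>C S c (m + n) v) =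
      (\<Sum>p\<in>UNIV. \<Sum>q\<in>UNIV. of_real (1 / 2 * (\<Sum>r\<in>UNIV. \<Gamma> a b r * \<Gamma> p q r)) *\<^sub>C N p q)"
  proof -
    have "(\<Sum>c\<in>UNIV. (\<i> * \<Gamma> a b c) *\<^sub>C S c (m + n) v) =
      (\<Sum>c\<in>UNIV. \<Sum>p\<in>UNIV. \<Sum>q\<in>UNIV. of_real (1 / 2 * (\<Gamma> a b c * \<Gamma> p q c)) *\<^sub>C N p q)"
      by (simp add: S_eq N_def cvec.scale_sum_right mult_ac)
    also have "\<dots> = (\<Sum>p\<in>UNIV. \<Sum>c\<in>UNIV. \<Sum>q\<in>UNIV.
        of_real (1 / 2 * (\<Gamma> a b c * \<Gamma> p q c)) *\<^sub>C N p q)"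
      by (rule sum.swap)
    also have "\<dots> = (\<Sum>p\<in>UNIV. \<Sum>q\<in>UNIV. \<Sum>c\<in>UNIV.
        of_real (1 / 2 * (\<Gamma> a b c * \<Gamma> p q c)) *\<^sub>C N p q)"
      by (intro sum.cong refl sum.swap)
    finally show ?thesis
      by (simp only: cvec.scale_sum_left[symmetric] sum_distrib_left of_real_sum)
  qed
  \<comment> \<open>This is the Jacobi identity after cyclic rotation of the indices, with one
    antisymmetry flip in the last term.\<close>
  have coeff: "1 / 2 * (\<Sum>r\<in>UNIV. \<Gamma> p r b * \<Gamma> a r q) + 1 / 2 * (\<Sum>r\<in>UNIV. \<Gamma> r q b * \<Gamma> a r p) =
      1 / 2 * (\<Sum>r\<in>UNIV. \<Gamma> a b r * \<Gamma> p q r)" for p q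
  proof -
    have "\<Gamma> b p e * \<Gamma> a e q + \<Gamma> p a e * \<Gamma> b e q + \<Gamma> a b e * \<Gamma> p e q =
        \<Gamma> p e b * \<Gamma> a e q + \<Gamma> e q b * \<Gamma> a e p - \<Gamma> a b e * \<Gamma> p q e" for e
      using cyclic[of b p e] cyclic[of p a e] cyclic[of b e q] antisym23[of p e q] by simp
    then show ?thesis
      using jacobi[where b = b and c = p and a = a and f = q]
      by (simp add: sum.distrib sum_subtractf)
  qed
  \<comment> \<open>The factors -i/2 and i leave n/2 times the Casimir sum 2 g, hence n g.\<close>
  have 4: "(\<Sum>c\<in>UNIV. \<Sum>d\<in>UNIV. (- \<i> / 2 * \<Gamma> c d b) *\<^sub>C (\<i> * \<Gamma> a c d * of_int n) *\<^sub>C w) =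
      delta_field (- n) (if a = b then of_int n * of_nat g else 0) m v"
  proof -
    have "(\<Sum>c\<in>UNIV. \<Sum>d\<in>UNIV. (- \<i> / 2 * \<Gamma> c d b) *\<^sub>C (\<i> * \<Gamma> a c d * of_int n) *\<^sub>C w) =
        of_real (1 / 2 * n * (\<Sum>c\<in>UNIV. \<Sum>d\<in>UNIV. \<Gamma> a c d * \<Gamma> b c d)) *\<^sub>C w"
      unfolding sum_distrib_left of_real_sum cvec.scale_sum_left
      by (intro sum.cong refl) (simp add: cyclic[of b] mult_ac)
    also have "\<dots> = delta_field (- n) (if a = b then of_int n * of_nat g else 0) m v"
      unfolding casimir by (auto simp: delta_field_def w_def)
    finally show ?thesis .
  qed
  show ?thesis
    unfolding S_nop 1 2 3 4 sum.distrib[symmetric] cvec.scale_left_distrib[symmetric]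
      of_real_add[symmetric] coeff ..
qed

section \<open>The action of B^a on the generating fields and their products\<close>

lemma B_psi: "B a n (\<Psi> b k v) =
    \<Psi> b k (B a n v) + (\<Sum>c\<in>UNIV. (\<i> * \<Gamma> a b c) *\<^sub>C \<Psi> c (k + n) v)"
  by (simp add: B_eq X_psi S_psi clinear_add[OF is_field_linear[OF psi_field]])

lemma B_X: "B a n (X b k v) = X b k (B a n v) +
    ((\<Sum>c\<in>UNIV. (\<i> * \<Gamma> a b c) *\<^sub>C X c (k + n) v)
      + delta_field (- n) (if a = b then of_int n * of_nat level else 0) k v)"
  by (simp add: B_eq X_X[of a n b k v] X_S[symmetric] clinear_add[OF is_field_linear[OF X_field]]
      add.commute delta_field_def add_eq_0_iff)

lemma B_S: "B a n (S b k v) = S b k (B a n v) +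
    ((\<Sum>c\<in>UNIV. (\<i> * \<Gamma> a b c) *\<^sub>C S c (k + n) v)
      + delta_field (- n) (if a = b then of_int n * of_nat g else 0) k v)"
  by (simp add: B_eq X_S S_S[of a n b k v] clinear_add[OF is_field_linear[OF S_field]])

text \<open>B acts on X and on S by the same formula up to the central constant \<kappa>, and \<mu>
  measures how far psi and Y fail to commute. The pair (\<kappa>, \<mu>) is (n level, 0) for Y = X
  and (n g, 1) for Y = S.\<close>

lemma B_nop:
  fixes Y :: "'i \<Rightarrow> 'h field_series"
  assumes Y: "\<And>b. is_field (Y b)"
    and BY: "\<And>b k v. B a n (Y b k v) = Y b k (B a n v) +
      ((\<Sum>c\<in>UNIV. (\<i> * \<Gamma> a b c) *\<^sub>C Y c (k + n) v)
        + delta_field (- n) (if a = b then \<kappa> else 0) k v)"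
    and \<Psi>Y: "\<And>b c j k. \<Psi> c j (Y b k v) - Y b k (\<Psi> c j v) =
      (\<Sum>e\<in>UNIV. (\<mu> * \<i> * \<Gamma> c b e) *\<^sub>C \<Psi> e (j + k) v)"
  shows "(\<Sum>b\<in>UNIV. B a n (nop 1 (\<Psi> b) (Y b) m v)) =
    (\<Sum>b\<in>UNIV. nop 1 (\<Psi> b) (Y b) m (B a n v))
    + (\<kappa> + 2 * of_int n * of_nat g * \<mu>) *\<^sub>C \<Psi> a (m + n - 1) v"
proof -
  define N where "N c d = nop 1 (\<Psi> c) (Y d) (m + n) v" for c d
  define C where "C b e = (\<Sum>f\<in>UNIV. (\<mu> * \<i> * \<Gamma> e b f) *\<^sub>C \<Psi> f (m + n - 1) v)" for b e
  have YZ: "\<Psi> e j (Y b k v) - 1 *\<^sub>C Y b k (\<Psi> e j v) = C b e" if "j + k = m + n - 1" for b e j k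
    using that by (simp add: \<Psi>Y C_def)
  have nop: "B a n (nop 1 (\<Psi> b) (Y b) m v) = nop 1 (\<Psi> b) (Y b) m (B a n v)
      + ((\<Sum>e\<in>UNIV. (\<i> * \<Gamma> a b e) *\<^sub>C N b e) + (\<Sum>e\<in>UNIV. (\<i> * \<Gamma> a b e) *\<^sub>C N e b)
      + (\<Sum>e\<in>UNIV. (\<i> * \<Gamma> a b e * of_int n) *\<^sub>C C b e)
      + \<kappa> *\<^sub>C (if a = b then \<Psi> b (m + n - 1) v else 0))" for b
    unfolding N_def
    by (subst structure_commutator_nop[where T = "B a n" and Y = \<Psi> and Z = Y and a = a and n = n
          and b = b and c = b and C = "C b",
          OF psi_field Y is_field_delta is_field_linear[OF B_is_field] B_psi BY YZ])
      (auto simp: nop_delta_right psi_field algebra_simps)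
  \<comment> \<open>Invariance of the contraction over b: renaming the summation indices turns one
    double sum into the negative of the other.\<close>
  have 1: "(\<Sum>b\<in>UNIV. \<Sum>e\<in>UNIV. (\<i> * \<Gamma> a b e) *\<^sub>C N b e)
      + (\<Sum>b\<in>UNIV. \<Sum>e\<in>UNIV. (\<i> * \<Gamma> a b e) *\<^sub>C N e b) = 0"
  proof -
    have "(\<Sum>b\<in>UNIV. \<Sum>e\<in>UNIV. (\<i> * \<Gamma> a b e) *\<^sub>C N e b) =
        (\<Sum>e\<in>UNIV. \<Sum>b\<in>UNIV. - ((\<i> * \<Gamma> a e b) *\<^sub>C N e b))"
      by (subst sum.swap, intro sum.cong refl, subst antisym23) simp
    then show ?thesis by (simp add: sum_negf)
  qed
  \<comment> \<open>The double commutator contributes i * i = -1, cancelled by rewriting \<Gamma> e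
    b f as minus \<Gamma> f b e. The sum over b and e is then the Casimir sum.\<close>
  have 2: "(\<Sum>b\<in>UNIV. \<Sum>e\<in>UNIV. (\<i> * \<Gamma> a b e * of_int n) *\<^sub>C C b e) =
      (2 * of_int n * of_nat g * \<mu>) *\<^sub>C \<Psi> a (m + n - 1) v"
  proof -
    have "(\<Sum>b\<in>UNIV. \<Sum>e\<in>UNIV. (\<i> * \<Gamma> a b e * of_int n) *\<^sub>C C b e) =
      (\<Sum>b\<in>UNIV. \<Sum>e\<in>UNIV. \<Sum>f\<in>UNIV.
        (of_int n * \<mu> * of_real (\<Gamma> a b e * \<Gamma> f b e)) *\<^sub>C \<Psi> f (m + n - 1) v)"
    proof (intro sum.cong refl)
      fix b e
      have "\<Gamma> e b f = - \<Gamma> f b e" for f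
        using antisym12[of f b e] cyclic[of b f e] cyclic[of f e b] by simp
      then show "(\<i> * \<Gamma> a b e * of_int n) *\<^sub>C C b e = (\<Sum>f\<in>UNIV.
          (of_int n * \<mu> * of_real (\<Gamma> a b e * \<Gamma> f b e)) *\<^sub>C \<Psi> f (m + n - 1) v)"
        unfolding C_def cvec.scale_sum_right by (intro sum.cong refl) (simp add: mult_ac)
    qed
    also have "\<dots> = (\<Sum>b\<in>UNIV. \<Sum>f\<in>UNIV. \<Sum>e\<in>UNIV.
        (of_int n * \<mu> * of_real (\<Gamma> a b e * \<Gamma> f b e)) *\<^sub>C \<Psi> f (m + n - 1) v)"
      by (intro sum.cong refl sum.swap)
    also have "\<dots> = (\<Sum>f\<in>UNIV. \<Sum>b\<in>UNIV. \<Sum>e\<in>UNIV.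
        (of_int n * \<mu> * of_real (\<Gamma> a b e * \<Gamma> f b e)) *\<^sub>C \<Psi> f (m + n - 1) v)"
      by (rule sum.swap)
    also have "\<dots> = (\<Sum>f\<in>UNIV.
        (of_int n * \<mu> * of_real (if a = f then 2 * real g else 0)) *\<^sub>C \<Psi> f (m + n - 1) v)"
      unfolding casimir[symmetric] by (simp add: cvec.scale_sum_left sum_distrib_left)
    also have "\<dots> = (\<Sum>f\<in>UNIV.
        (of_int n * \<mu> * 2 * of_nat g) *\<^sub>C (if a = f then \<Psi> f (m + n - 1) v else 0))"
      by (intro sum.cong refl) simp
    also have "\<dots> = (2 * of_int n * of_nat g * \<mu>) *\<^sub>C \<Psi> a (m + n - 1) v"
      unfolding sum_if_scaleC by (simp add: mult_ac)
    finally show ?thesis .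
  qed
  show ?thesis
    unfolding nop sum.distrib 1 2 sum_if_scaleC by (simp add: cvec.scale_left_distrib add_ac)
qed

section \<open>The field G\<close>

lemma G_eq: "G_field \<Gamma> d X \<psi> n v = of_real (1 / sqrt d) *\<^sub>C
    ((\<Sum>a\<in>UNIV. nop 1 (\<Psi> a) (X a) n v) + (1 / 3) *\<^sub>C (\<Sum>a\<in>UNIV. nop 1 (\<Psi> a) (S a) n v))"
  by (simp add: G_field_def nth_product_minus_one sum.distrib cvec.scale_sum_right)

lemma G_eq_lincomb: "G_field \<Gamma> d X \<psi> = (\<lambda>n v. of_real (1 / sqrt d) *\<^sub>C
    ((\<Sum>a\<in>UNIV. 1 *\<^sub>C nop 1 (\<Psi> a) (X a) n v) + (\<Sum>a\<in>UNIV. (1 / 3) *\<^sub>C nop 1 (\<Psi> a) (S a) n v)))"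
  by (intro ext) (simp add: G_eq cvec.scale_sum_right)

lemma G_is_field: "is_field (G_field \<Gamma> d X \<psi>)"
  unfolding G_eq_lincomb
  by (intro is_field_scale is_field_add is_field_lincomb is_field_nop psi_field X_field S_field
      finite)

lemma G_adjoint: "has_adjoint_field (G_field \<Gamma> d X \<psi>)"
  unfolding G_eq_lincomb
  by (intro has_adjoint_field_scale has_adjoint_field_add has_adjoint_field_lincomb
      has_adjoint_field_nop psi_field X_field S_field psi_adjoint X_adjoint S_adjoint finite) auto

lemma B_G:
  assumes "d = real level + real g"
  shows "B a n (G_field \<Gamma> d X \<psi> m v) =
    G_field \<Gamma> d X \<psi> m (B a n v) + (of_int n * of_real (sqrt d)) *\<^sub>C \<Psi> a (m + n - 1) v"
proof -
  have "B a n (G_field \<Gamma> d X \<psi> m v) = of_real (1 / sqrt d) *\<^sub>C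
      ((\<Sum>b\<in>UNIV. B a n (nop 1 (\<Psi> b) (X b) m v))
      + (1 / 3) *\<^sub>C (\<Sum>b\<in>UNIV. B a n (nop 1 (\<Psi> b) (S b) m v)))"
    by (simp add: G_eq clinear_add[OF is_field_linear[OF B_is_field]]
        clinear_scaleC[OF is_field_linear[OF B_is_field]]
        clinear_sum[OF is_field_linear[OF B_is_field]])
  also have "(\<Sum>b\<in>UNIV. B a n (nop 1 (\<Psi> b) (X b) m v)) =
      (\<Sum>b\<in>UNIV. nop 1 (\<Psi> b) (X b) m (B a n v))
      + (of_int n * of_nat level) *\<^sub>C \<Psi> a (m + n - 1) v"
    using B_nop[where Y = X and m = m and v = v and \<mu> = 0, OF X_field B_X] by (simp add: X_psi)
  also have "(\<Sum>b\<in>UNIV. B a n (nop 1 (\<Psi> b) (S b) m v)) =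
      (\<Sum>b\<in>UNIV. nop 1 (\<Psi> b) (S b) m (B a n v))
      + (3 * of_int n * of_nat g) *\<^sub>C \<Psi> a (m + n - 1) v"
  proof -
    have "\<Psi> c j (S b k v) - S b k (\<Psi> c j v) = (\<Sum>e\<in>UNIV. (1 * \<i> * \<Gamma> c b e) *\<^sub>C \<Psi> e (j + k) v)"
      for b c j k
      unfolding psi_S by (simp add: antisym12[of b c] add.commute)
    from B_nop[where Y = S and m = m and v = v and \<mu> = 1, OF S_field B_S this] show ?thesis by (simp add: algebra_simps)
  qed
  also have "of_real (1 / sqrt d) *\<^sub>C
      ((\<Sum>b\<in>UNIV. nop 1 (\<Psi> b) (X b) m (B a n v)) + (of_int n * of_nat level) *\<^sub>C \<Psi> a (m + n - 1) v
      + (1 / 3) *\<^sub>C ((\<Sum>b\<in>UNIV. nop 1 (\<Psi> b) (S b) m (B a n v))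
        + (3 * of_int n * of_nat g) *\<^sub>C \<Psi> a (m + n - 1) v)) =
      G_field \<Gamma> d X \<psi> m (B a n v) +
      (of_real (1 / sqrt d) * (of_int n * of_real d)) *\<^sub>C \<Psi> a (m + n - 1) v"
    unfolding G_eq assms
    by (simp add: cvec.scale_right_distrib cvec.scale_left_distrib algebra_simps)
  also have "of_real (1 / sqrt d) * (of_int n * of_real d) = (of_int n * of_real (sqrt d) :: complex)"
  proof -
    \<comment> \<open>This also covers d = 0, where both sides are 0 by the convention for division
      by zero.\<close>
    have "d / sqrt d = sqrt d"
      using assms by (intro real_div_sqrt) simp
    then have "1 / sqrt d * (n * d) = n * sqrt d"
      by (metis mult.commute mult.left_commute times_divide_eq_left mult_1)
    then show ?thesis by (metis of_real_mult of_real_of_int_eq)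
  qed
  finally show ?thesis .
qed

text \<open>Contracting psi^a with the outer fermion gives X^a + S^a / 3; passing psi^a through S^b
  leaves a bilinear in fermions that equals 2 S^a before the factor 1/3. The sum is B^a.\<close>

lemma psi_G: "\<Psi> a n (G_field \<Gamma> d X \<psi> m v) =
    - G_field \<Gamma> d X \<psi> m (\<Psi> a n v) + of_real (1 / sqrt d) *\<^sub>C B a (m + n) v"
proof -
  note lin = is_field_linear[OF psi_field]
  have X: "\<Psi> a n (nop 1 (\<Psi> b) (X b) m v) =
      - nop 1 (\<Psi> b) (X b) m (\<Psi> a n v) + 1 *\<^sub>C (if a = b then X b (m + n) v else 0)" for b
    using nop_commutator[where T = "\<Psi> a n" and A = "\<Psi> b" and B = "X b" and \<alpha> = "- 1"
        and \<beta> = 1 and s = 1 and m = m and v = v,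
        OF psi_field X_field is_field_delta is_field_zero lin _ psi_psi_delta] X_psi
    by (simp add: nop_delta_left nop_zero_right X_field psi_field)
  have S: "\<Psi> a n (nop 1 (\<Psi> b) (S b) m v) =
      - nop 1 (\<Psi> b) (S b) m (\<Psi> a n v) + (1 *\<^sub>C (if a = b then S b (m + n) v else 0)
      + (\<Sum>e\<in>UNIV. (\<i> * \<Gamma> b a e) *\<^sub>C nop (- 1) (\<Psi> b) (\<Psi> e) (m + n) v))" for b
  proof -
    let ?D = "\<lambda>k v. \<Sum>e\<in>UNIV. (- \<i> * \<Gamma> b a e) *\<^sub>C \<Psi> e (k + n) v"
    have D: "is_field ?D"
      by (intro is_field_lincomb is_field_shift psi_field finite)
    have "\<Psi> a n (nop 1 (\<Psi> b) (S b) m v) = - nop 1 (\<Psi> b) (S b) m (\<Psi> a n v)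
        - nop (- 1) (\<Psi> b) ?D m v + (if a = b then S b (m + n) v else 0)"
      using nop_commutator[where T = "\<Psi> a n" and A = "\<Psi> b" and B = "S b" and \<alpha> = "- 1"
          and \<beta> = 1 and s = 1 and m = m and v = v,
          OF psi_field S_field is_field_delta D lin _ psi_psi_delta] psi_S
      by (simp add: nop_delta_left S_field)
    \<comment> \<open>Moving the odd psi^a past psi^b has turned the ordering sign 1 into -1, which
      is the sign of the ordering in S.\<close>
    also have "nop (- 1) (\<Psi> b) ?D m v =
        (\<Sum>e\<in>UNIV. (- \<i> * \<Gamma> b a e) *\<^sub>C nop (- 1) (\<Psi> b) (\<Psi> e) (m + n) v)"
      by (subst nop_lincomb_right) (auto intro: is_field_shift psi_field simp: nop_shift_right)
    finally show ?thesis by (simp add: sum_negf)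
  qed
  have two_S: "(\<Sum>b\<in>UNIV. \<Sum>e\<in>UNIV. (\<i> * \<Gamma> b a e) *\<^sub>C nop (- 1) (\<Psi> b) (\<Psi> e) (m + n) v) =
      2 *\<^sub>C S a (m + n) v"
    unfolding S_eq cvec.scale_sum_right
    by (intro sum.cong refl) (simp add: antisym23[of _ a])
  have "\<Psi> a n (G_field \<Gamma> d X \<psi> m v) = of_real (1 / sqrt d) *\<^sub>C
      (- (\<Sum>b\<in>UNIV. nop 1 (\<Psi> b) (X b) m (\<Psi> a n v)) + X a (m + n) v
      + (1 / 3) *\<^sub>C (- (\<Sum>b\<in>UNIV. nop 1 (\<Psi> b) (S b) m (\<Psi> a n v))
        + (S a (m + n) v + 2 *\<^sub>C S a (m + n) v)))"
    unfolding G_eq clinear_scaleC[OF lin] clinear_add[OF lin] clinear_sum[OF lin] X S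
      sum.distrib sum_if_scaleC two_S sum_negf unfolding cvec.scale_one ..
  also have "S a (m + n) v + 2 *\<^sub>C S a (m + n) v = 3 *\<^sub>C S a (m + n) v"
    using cvec.scale_left_distrib[of 1 2 "S a (m + n) v"] by simp
  finally show ?thesis
    by (simp add: G_eq B_field_def cvec.scale_right_distrib cvec.scale_right_diff_distrib
        algebra_simps)
qed

end


section \<open>Structure constants\<close>

lemma cbasis_coeff_zero:
  fixes x :: "'i::finite \<Rightarrow> 'g::complex_vector"
  assumes "is_cbasis x" "(\<Sum>c\<in>UNIV. q c *\<^sub>C x c) = 0"
  shows "q c = 0"
proof -
  have inj: "inj x" and ind: "cvec.independent (range x)"
    using assms(1) by (auto simp: is_cbasis_def)
  have "(\<Sum>v\<in>range x. q (inv x v) *\<^sub>C v) = 0"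
    using assms(2) inj by (simp add: sum.reindex)
  then have "q (inv x (x c)) = 0"
    by (intro cvec.independentD[OF ind, of "range x"]) auto
  then show ?thesis using inj by simp
qed

text \<open>The two factors i multiply to -1, so the coefficients are real and the resulting
  identities can be compared in \<Gamma> itself.\<close>

lemma iterated_bracket:
  fixes x :: "'i::finite \<Rightarrow> 'g::complex_vector"
  assumes "lie_bracket br"
    and "\<forall>a b. br (x a) (x b) = (\<Sum>c\<in>UNIV. (\<i> * of_real (\<Gamma> a b c)) *\<^sub>C x c)"
  shows "br (x a) (br (x b) (x c)) =
    (\<Sum>f\<in>UNIV. of_real (- (\<Sum>e\<in>UNIV. \<Gamma> b c e * \<Gamma> a e f)) *\<^sub>C x f)"
proof -
  have lin: "clinear (br (x a))"
    using assms(1) by (auto simp: lie_bracket_def cbilinear_def)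
  have "br (x a) (br (x b) (x c)) =
      (\<Sum>e\<in>UNIV. \<Sum>f\<in>UNIV. of_real (- (\<Gamma> b c e * \<Gamma> a e f)) *\<^sub>C x f)"
    unfolding assms(2)[rule_format, of b c] clinear_sum[OF lin] clinear_scaleC[OF lin]
      assms(2)[rule_format, of a] cvec.scale_sum_right
    by (intro sum.cong refl) (simp add: mult_ac)
  also have "\<dots> = (\<Sum>f\<in>UNIV. \<Sum>e\<in>UNIV. of_real (- (\<Gamma> b c e * \<Gamma> a e f)) *\<^sub>C x f)"
    by (rule sum.swap)
  finally show ?thesis
    by (simp only: cvec.scale_sum_left[symmetric] of_real_sum[symmetric] sum_negf)
qed

lemma structure_constants_jacobi:
  fixes x :: "'i::finite \<Rightarrow> 'g::complex_vector"
  assumes "lie_bracket br" "is_cbasis x"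
    and "\<forall>a b. br (x a) (x b) = (\<Sum>c\<in>UNIV. (\<i> * of_real (\<Gamma> a b c)) *\<^sub>C x c)"
  shows "(\<Sum>e\<in>UNIV. \<Gamma> b c e * \<Gamma> a e f + \<Gamma> c a e * \<Gamma> b e f + \<Gamma> a b e * \<Gamma> c e f) = 0"
proof -
  have "br (x a) (br (x b) (x c)) + br (x b) (br (x c) (x a)) + br (x c) (br (x a) (x b)) = 0"
    using assms(1) by (auto simp: lie_bracket_def)
  then have "(\<Sum>f\<in>UNIV. (of_real (- (\<Sum>e\<in>UNIV. \<Gamma> b c e * \<Gamma> a e f)) +
      of_real (- (\<Sum>e\<in>UNIV. \<Gamma> c a e * \<Gamma> b e f)) +
      of_real (- (\<Sum>e\<in>UNIV. \<Gamma> a b e * \<Gamma> c e f))) *\<^sub>C x f) = 0"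
    unfolding iterated_bracket[OF assms(1,3)] sum.distrib[symmetric]
      cvec.scale_left_distrib[symmetric] .
  from cbasis_coeff_zero[OF assms(2) this, of f]
  have "complex_of_real (- ((\<Sum>e\<in>UNIV. \<Gamma> b c e * \<Gamma> a e f) + (\<Sum>e\<in>UNIV. \<Gamma> c a e * \<Gamma> b e f)
      + (\<Sum>e\<in>UNIV. \<Gamma> a b e * \<Gamma> c e f))) = 0"
    by (simp add: algebra_simps)
  then show ?thesis
    unfolding of_real_eq_0_iff by (simp add: sum.distrib)
qed

text \<open>The basis is orthonormal for the normalized form, so the sum of the squares of ad x_a is
  the Casimir element in the adjoint representation and acts by 2 g. Coefficients are then compared
  in the basis.\<close>

lemma structure_constants_casimir:
  fixes x :: "'i::finite \<Rightarrow> 'g::complex_vector"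
  assumes "lie_bracket br" "is_cbasis x"
    and "\<forall>a b. br (x a) (x b) = (\<Sum>c\<in>UNIV. (\<i> * of_real (\<Gamma> a b c)) *\<^sub>C x c)"
    and antisym: "\<forall>a b c. \<Gamma> a b c = - \<Gamma> b a c \<and> \<Gamma> a b c = - \<Gamma> a c b"
    and "normalized_form br K" "\<forall>a b. K (x a) (x b) = (if a = b then 1 else 0)"
    and "is_dual_coxeter_number br g"
  shows "(\<Sum>c\<in>UNIV. \<Sum>d\<in>UNIV. \<Gamma> b c d * \<Gamma> f c d) = (if b = f then 2 * real g else 0)"
proof -
  have inj: "inj x" using assms(2) by (simp add: is_cbasis_def)
  have "orthonormal_basis K (range x)"
    using assms(2,6) by (auto simp: orthonormal_basis_def is_cbasis_def inj_eq)
  then have "(\<Sum>y\<in>range x. br y (br y (x b))) = (2 * of_nat g) *\<^sub>C x b"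
    using assms(5) assms(7)[unfolded is_dual_coxeter_number_def, rule_format, of K "range x" "x b"]
    by simp
  then have "(\<Sum>a\<in>UNIV. br (x a) (br (x a) (x b))) = (2 * of_nat g) *\<^sub>C x b"
    by (simp add: sum.reindex[OF inj])
  moreover have "(\<Sum>a\<in>UNIV. br (x a) (br (x a) (x b))) =
      (\<Sum>f\<in>UNIV. of_real (\<Sum>a\<in>UNIV. - (\<Sum>e\<in>UNIV. \<Gamma> a b e * \<Gamma> a e f)) *\<^sub>C x f)"
    unfolding iterated_bracket[OF assms(1,3)] of_real_sum cvec.scale_sum_left
    by (rule sum.swap)
  moreover have "(2 * of_nat g) *\<^sub>C x b =
      (\<Sum>f\<in>UNIV. (if b = f then 2 * of_nat g else 0) *\<^sub>C x f)"
  proof -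
    have "(\<Sum>f\<in>UNIV. (if b = f then 2 * of_nat g else 0) *\<^sub>C x f) =
        (\<Sum>f\<in>UNIV. (2 * of_nat g) *\<^sub>C (if b = f then x f else 0))"
      by (intro sum.cong refl) simp
    then show ?thesis unfolding sum_if_scaleC ..
  qed
  ultimately have "(\<Sum>f\<in>UNIV. of_real (\<Sum>a\<in>UNIV. - (\<Sum>e\<in>UNIV. \<Gamma> a b e * \<Gamma> a e f)) *\<^sub>C x f) =
      (\<Sum>f\<in>UNIV. (if b = f then 2 * of_nat g else 0) *\<^sub>C x f)"
    by (simp only:)
  then have "(\<Sum>f\<in>UNIV. (of_real (\<Sum>a\<in>UNIV. - (\<Sum>e\<in>UNIV. \<Gamma> a b e * \<Gamma> a e f))
      - (if b = f then 2 * of_nat g else 0)) *\<^sub>C x f) = 0"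
    unfolding cvec.scale_left_diff_distrib sum_subtractf by (simp only: diff_self)
  from cbasis_coeff_zero[OF assms(2) this, of f]
  have "complex_of_real (\<Sum>a\<in>UNIV. - (\<Sum>e\<in>UNIV. \<Gamma> a b e * \<Gamma> a e f)) =
      of_real (if b = f then 2 * real g else 0)"
    by (auto split: if_splits)
  then have "(\<Sum>a\<in>UNIV. \<Sum>e\<in>UNIV. - (\<Gamma> a b e * \<Gamma> a e f)) = (if b = f then 2 * real g else 0)"
    unfolding of_real_eq_iff by (simp add: sum_negf)
  moreover have "- (\<Gamma> a b e * \<Gamma> a e f) = \<Gamma> b e a * \<Gamma> f e a" for a e
  proof -
    have "\<Gamma> a b e = - \<Gamma> b a e" "\<Gamma> b a e = - \<Gamma> b e a"
      "\<Gamma> a e f = - \<Gamma> a f e" "\<Gamma> a f e = - \<Gamma> f a e" "\<Gamma> f a e = - \<Gamma> f e a"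
      using antisym by blast+
    then show ?thesis by simp
  qed
  moreover have "(\<Sum>a\<in>UNIV. \<Sum>e\<in>UNIV. \<Gamma> b e a * \<Gamma> f e a) =
      (\<Sum>c\<in>UNIV. \<Sum>d\<in>UNIV. \<Gamma> b c d * \<Gamma> f c d)"
    by (rule sum.swap)
  ultimately show ?thesis by (simp only:)
qed


section \<open>The vacuum representations and their tensor product\<close>

text \<open>The vectors annihilated by all sufficiently high modes form a subspace that contains
  \<Omega> and, by the commutation relations, is stable under every mode. By irreducibility it is
  the whole space.\<close>

lemma is_field_boson:
  assumes "boson_vacuum_rep \<Gamma> level X \<Omega>"
  shows "is_field (X a)"
proof -
  have lin: "\<And>a n. clinear (X a n)"
    and comm: "\<And>a b m n v. X a m (X b n v) - X b n (X a m v) =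
        (\<Sum>c\<in>UNIV. (\<i> * of_real (\<Gamma> a b c)) *\<^sub>C X c (m + n) v) +
        (if a = b \<and> m + n = 0 then (of_int m * of_nat level) *\<^sub>C v else 0)"
    and irr: "irreducible_ops {X a n | a n. True}"
    and \<Omega>: "cinner \<Omega> \<Omega> = 1" "{v. \<forall>a n. n > 0 \<longrightarrow> X a n v = 0} = cvec.span {\<Omega>}"
    using assms unfolding boson_vacuum_rep_def by blast+
  define W where "W = {v. \<forall>a. \<forall>\<^sub>F n in at_top. X a n v = 0}"
  have "cvec.subspace W"
    unfolding W_def
  proof (rule cvec.subspaceI; safe)
    fix u v a assume "\<forall>a. \<forall>\<^sub>F n in at_top. X a n u = 0" "\<forall>a. \<forall>\<^sub>F n in at_top. X a n v = 0"
    from this(1)[rule_format, of a] this(2)[rule_format, of a]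
    show "\<forall>\<^sub>F n in at_top. X a n (u + v) = 0"
      by eventually_elim (simp add: clinear_add[OF lin])
  next
    fix c v a assume "\<forall>a. \<forall>\<^sub>F n in at_top. X a n v = 0"
    from this[rule_format, of a] show "\<forall>\<^sub>F n in at_top. X a n (c *\<^sub>C v) = 0"
      by eventually_elim (simp add: clinear_scaleC[OF lin])
  qed (simp add: clinear_zero[OF lin])
  moreover have "X b m v \<in> W" if "v \<in> W" for b m v
    unfolding W_def
  proof safe
    fix a
    have "\<forall>\<^sub>F n in at_top. X a n v = 0"
      using that by (simp add: W_def)
    \<comment> \<open>Commuting the two modes leaves X c (n + m) on v. Finiteness of the index set
      gives one bound for all c, and n > -m removes the central term.\<close>
    moreover have "\<forall>\<^sub>F n in at_top. X c (n + m) v = 0" for c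
      using that by (intro eventually_at_top_int_shift) (simp add: W_def)
    then have "\<forall>\<^sub>F n in at_top. \<forall>c\<in>UNIV. X c (n + m) v = 0"
      by (intro eventually_ball_finite) auto
    moreover have "\<forall>\<^sub>F n in at_top. n > - m"
      by (rule eventually_gt_at_top)
    ultimately show "\<forall>\<^sub>F n in at_top. X a n (X b m v) = 0"
    proof eventually_elim
      case (elim n)
      then show ?case using comm[of a n b m v] by (simp add: clinear_zero[OF lin])
    qed
  qed
  then have "\<forall>T\<in>{X a n | a n. True}. T ` W \<subseteq> W" by auto
  ultimately have "W = {0} \<or> W = UNIV"
    using irr unfolding irreducible_ops_def by blast
  moreover have "\<Omega> \<in> W"
  proof -
    have "X a n \<Omega> = 0" if "n > 0" for a n
      using that \<Omega>(2) cvec.span_base[of \<Omega> "{\<Omega>}"] by blast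
    then show ?thesis
      unfolding W_def by (auto intro: eventually_mono[OF eventually_gt_at_top[of 0]])
  qed
  moreover have "\<Omega> \<noteq> 0" using \<Omega>(1) by auto
  ultimately have "W = UNIV" by auto
  then show ?thesis
    unfolding is_field_def using lin by (auto simp: W_def)
qed

lemma half_ints_shift [simp]: "of_int n + 1 / 2 \<in> half_ints"
  by (auto simp: half_ints_def)

lemma psi_field_relations:
  assumes "fermion_vacuum_rep \<psi> \<Omega>"
  shows "clinear (psi_field \<psi> a m)"
    and "psi_field \<psi> a m (psi_field \<psi> b n v) =
      - psi_field \<psi> b n (psi_field \<psi> a m v) + (if a = b \<and> m + n = - 1 then v else 0)"
    and "cinner (psi_field \<psi> a m u) v = cinner u (psi_field \<psi> a (- 1 - m) v)"
proof -
  have lin: "\<And>a m. m \<in> half_ints \<Longrightarrow> clinear (\<psi> a m)"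
    and anticomm: "\<And>a b v m n. m \<in> half_ints \<Longrightarrow> n \<in> half_ints \<Longrightarrow>
        \<psi> a m (\<psi> b n v) + \<psi> b n (\<psi> a m v) = (if a = b \<and> m + n = 0 then v else 0)"
    and adj: "\<And>a u v m. m \<in> half_ints \<Longrightarrow> cinner (\<psi> a m u) v = cinner u (\<psi> a (- m) v)"
    using assms unfolding fermion_vacuum_rep_def by blast+
  show "clinear (psi_field \<psi> a m)"
    unfolding psi_field_def by (intro lin half_ints_shift)
  have "(of_int m + 1 / 2 :: rat) + (of_int n + 1 / 2) = of_int (m + n + 1)"
    by simp
  then have "(of_int m + 1 / 2 :: rat) + (of_int n + 1 / 2) = 0 \<longleftrightarrow> m + n = - 1"
    unfolding of_int_eq_0_iff by linarith
  then have "psi_field \<psi> a m (psi_field \<psi> b n v) + psi_field \<psi> b n (psi_field \<psi> a m v) =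
      (if a = b \<and> m + n = - 1 then v else 0)"
    unfolding psi_field_def anticomm[OF half_ints_shift half_ints_shift] by simp
  then show "psi_field \<psi> a m (psi_field \<psi> b n v) =
      - psi_field \<psi> b n (psi_field \<psi> a m v) + (if a = b \<and> m + n = - 1 then v else 0)"
    by (simp add: algebra_simps)
  have "- (of_int m + 1 / 2 :: rat) = of_int (- 1 - m) + 1 / 2" by simp
  then show "cinner (psi_field \<psi> a m u) v = cinner u (psi_field \<psi> a (- 1 - m) v)"
    unfolding psi_field_def using adj[OF half_ints_shift] by metis
qed

text \<open>The irreducibility argument for the bosons, now with anticommutators: beyond n = -1 - m
  only the reordered term remains.\<close>

lemma is_field_fermion:
  fixes \<psi> :: "'i \<Rightarrow> rat \<Rightarrow> 'f::complex_inner \<Rightarrow> 'f"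
  assumes "fermion_vacuum_rep \<psi> \<Omega>"
  shows "is_field (psi_field \<psi> a)"
proof -
  note lin = psi_field_relations(1)[OF assms]
  have irr: "irreducible_ops {\<psi> a m | a m. m \<in> half_ints}"
    and \<Omega>: "cinner \<Omega> \<Omega> = 1" "\<And>a m. m \<in> half_ints \<Longrightarrow> m > 0 \<Longrightarrow> \<psi> a m \<Omega> = 0"
    using assms unfolding fermion_vacuum_rep_def by blast+
  define W where "W = {v. \<forall>a. \<forall>\<^sub>F n in at_top. psi_field \<psi> a n v = 0}"
  have "cvec.subspace W"
    unfolding W_def
  proof (rule cvec.subspaceI; safe)
    fix u v a assume "\<forall>a. \<forall>\<^sub>F n in at_top. psi_field \<psi> a n u = 0"
      "\<forall>a. \<forall>\<^sub>F n in at_top. psi_field \<psi> a n v = 0"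
    from this(1)[rule_format, of a] this(2)[rule_format, of a]
    show "\<forall>\<^sub>F n in at_top. psi_field \<psi> a n (u + v) = 0"
      by eventually_elim (simp add: clinear_add[OF lin])
  next
    fix c v a assume "\<forall>a. \<forall>\<^sub>F n in at_top. psi_field \<psi> a n v = 0"
    from this[rule_format, of a] show "\<forall>\<^sub>F n in at_top. psi_field \<psi> a n (c *\<^sub>C v) = 0"
      by eventually_elim (simp add: clinear_scaleC[OF lin])
  qed (simp add: clinear_zero[OF lin])
  moreover have "psi_field \<psi> b m v \<in> W" if "v \<in> W" for b m v
    unfolding W_def
  proof safe
    fix a
    have "\<forall>\<^sub>F n in at_top. psi_field \<psi> a n v = 0"
      using that by (simp add: W_def)
    moreover have "\<forall>\<^sub>F n in at_top. n > - 1 - m"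
      by (rule eventually_gt_at_top)
    ultimately show "\<forall>\<^sub>F n in at_top. psi_field \<psi> a n (psi_field \<psi> b m v) = 0"
    proof eventually_elim
      case (elim n)
      then show ?case
        using psi_field_relations(2)[OF assms, of a n b m v] by (simp add: clinear_zero[OF lin])
    qed
  qed
  then have "\<forall>T\<in>{\<psi> a m | a m. m \<in> half_ints}. T ` W \<subseteq> W"
    by (auto simp: half_ints_def psi_field_def)
  ultimately have "W = {0} \<or> W = UNIV"
    using irr unfolding irreducible_ops_def by blast
  moreover have "\<Omega> \<in> W"
  proof -
    have "psi_field \<psi> a n \<Omega> = 0" if "n > 0" for a n
      unfolding psi_field_def using that by (intro \<Omega>(2)) (auto intro: add_pos_pos)
    then show ?thesis
      unfolding W_def by (auto intro: eventually_mono[OF eventually_gt_at_top[of 0]])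
  qed
  moreover have "\<Omega> \<noteq> 0" using \<Omega>(1) by auto
  ultimately have "W = UNIV" by auto
  then show ?thesis
    unfolding is_field_def using lin by (auto simp: W_def)
qed

lemma is_field_if_on_span:
  assumes lin: "\<And>k. clinear (A k)" and "\<And>v. v \<in> V \<Longrightarrow> \<forall>\<^sub>F k in at_top. A k v = 0"
    and "cvec.span V = UNIV"
  shows "is_field A"
proof -
  have "cvec.subspace {v. \<forall>\<^sub>F k in at_top. A k v = 0}"
  proof (rule cvec.subspaceI; safe)
    fix u v assume "\<forall>\<^sub>F k in at_top. A k u = 0" "\<forall>\<^sub>F k in at_top. A k v = 0"
    then show "\<forall>\<^sub>F k in at_top. A k (u + v) = 0"
      by eventually_elim (simp add: clinear_add[OF lin])
  next
    fix c v assume "\<forall>\<^sub>F k in at_top. A k v = 0"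
    then show "\<forall>\<^sub>F k in at_top. A k (c *\<^sub>C v) = 0"
      by eventually_elim (simp add: clinear_scaleC[OF lin])
  qed (simp add: clinear_zero[OF lin])
  then have "cvec.span V \<subseteq> {v. \<forall>\<^sub>F k in at_top. A k v = 0}"
    using assms(2) by (intro cvec.span_minimal) auto
  then show ?thesis using assms(3) lin by (auto simp: is_field_def)
qed

lemma adjoint_if_on_span:
  assumes S: "clinear S" and T: "clinear T"
    and eq: "\<And>u v. u \<in> V \<Longrightarrow> v \<in> V \<Longrightarrow> cinner (S u) v = cinner u (T v)"
    and span: "cvec.span V = UNIV"
  shows "cinner (S u) v = cinner u (T v)"
proof -
  have 1: "cinner (S u) v = cinner u (T v)" if "v \<in> V" for u v
  proof -
    have "cvec.subspace {u. cinner (S u) v = cinner u (T v)}"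
      by (rule cvec.subspaceI)
        (simp_all add: clinear_add[OF S] clinear_scaleC[OF S] clinear_zero[OF S]
          cinner_add_left cinner_scaleC_left)
    then have "cvec.span V \<subseteq> {u. cinner (S u) v = cinner u (T v)}"
      using eq that by (intro cvec.span_minimal) auto
    then show ?thesis using span by auto
  qed
  have "cvec.subspace {v. cinner (S u) v = cinner u (T v)}"
    by (rule cvec.subspaceI)
      (simp_all add: clinear_add[OF T] clinear_scaleC[OF T] clinear_zero[OF T]
        cinner_add_right cinner_scaleC_right)
  then have "cvec.span V \<subseteq> {v. cinner (S u) v = cinner u (T v)}"
    using 1 by (intro cvec.span_minimal) auto
  then show ?thesis using span by auto
qed

lemma susy_modes_tensor:
  fixes \<Gamma> :: "'i::finite \<Rightarrow> 'i \<Rightarrow> 'i \<Rightarrow> real"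
    and tens :: "'l::complex_inner \<Rightarrow> 'f::complex_inner \<Rightarrow> 'h::complex_inner"
  assumes antisym: "\<forall>a b c. \<Gamma> a b c = - \<Gamma> b a c \<and> \<Gamma> a b c = - \<Gamma> a c b"
    and jacobi: "\<And>a b c f.
      (\<Sum>e\<in>UNIV. \<Gamma> b c e * \<Gamma> a e f + \<Gamma> c a e * \<Gamma> b e f + \<Gamma> a b e * \<Gamma> c e f) = 0"
    and casimir: "\<And>a e.
      (\<Sum>b\<in>UNIV. \<Sum>c\<in>UNIV. \<Gamma> a b c * \<Gamma> e b c) = (if a = e then 2 * real g else 0)"
    and bosons: "boson_vacuum_rep \<Gamma> level XL \<Omega>L"
    and fermions: "fermion_vacuum_rep \<psi>F \<Omega>F"
    and tensor: "is_tensor_product tens"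
    and X: "\<forall>a n. acts_on_first tens (XL a n) (X a n)"
    and \<psi>: "\<forall>a. \<forall>m\<in>half_ints. acts_on_second tens (\<psi>F a m) (\<psi> a m)"
  shows "susy_modes \<Gamma> level g X \<psi>"
proof
  \<comment> \<open>Every condition is linear or sesquilinear in its vectors, so it is enough to
    check it on pure tensors.\<close>
  let ?V = "{tens u v | u v. True}"
  have span: "cvec.span ?V = UNIV"
    and cinner_tens: "\<And>u v u' v'. cinner (tens u v) (tens u' v') = cinner u u' * cinner v v'"
    and tens1: "\<And>v. clinear (\<lambda>u. tens u v)" and tens2: "\<And>u. clinear (tens u)"
    using tensor unfolding is_tensor_product_def cbilinear_def by blast+
  have X_lin: "\<And>a n. clinear (X a n)" and X_tens: "\<And>a n u v. X a n (tens u v) = tens (XL a n u) v"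
    using X by (auto simp: acts_on_first_def)
  have \<psi>_lin: "\<And>a n. clinear (psi_field \<psi> a n)"
    and \<psi>_tens: "\<And>a n u v. psi_field \<psi> a n (tens u v) = tens u (psi_field \<psi>F a n v)"
    using \<psi> by (auto simp: acts_on_second_def psi_field_def)
  show X_field: "is_field (X a)" for a
  proof (rule is_field_if_on_span[OF X_lin _ span])
    fix w assume "w \<in> ?V"
    then obtain u v where w: "w = tens u v" by blast
    show "\<forall>\<^sub>F k in at_top. X a k w = 0"
      using is_field_eventually[OF is_field_boson[OF bosons], of a u]
      by eventually_elim (simp add: w X_tens clinear_zero[OF tens1])
  qed
  show \<psi>_field: "is_field (psi_field \<psi> a)" for a
  proof (rule is_field_if_on_span[OF \<psi>_lin _ span])
    fix w assume "w \<in> ?V"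
    then obtain u v where w: "w = tens u v" by blast
    show "\<forall>\<^sub>F k in at_top. psi_field \<psi> a k w = 0"
      using is_field_eventually[OF is_field_fermion[OF fermions], of a v]
      by eventually_elim (simp add: w \<psi>_tens clinear_zero[OF tens2])
  qed
  show "has_adjoint_field (X a)" for a
  proof -
    have "cinner (XL a k u) v = cinner u (XL a (- k) v)" for k u v
      by (rule bosons[unfolded boson_vacuum_rep_def, THEN conjunct2, THEN conjunct2, THEN conjunct1,
            rule_format])
    then have adj: "cinner (X a k (tens u v)) (tens u' v') = cinner (tens u v) (X a (- k) (tens u' v'))"
      for k u v u' v'
      by (simp only: X_tens cinner_tens)
    have "cinner (X a k u) v = cinner u (X a (- k) v)" for k u v
      by (rule adjoint_if_on_span[OF X_lin X_lin _ span]) (clarify, rule adj)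
    \<comment> \<open>The adjoint of X_k is X_(-k), so the adjoint field is X shifted by one
      mode.\<close>
    moreover have "- k = - 1 - k + 1" for k :: int by simp
    ultimately show ?thesis
      unfolding has_adjoint_field_def
      by (intro exI[of _ "\<lambda>k. X a (k + 1)"] conjI allI is_field_shift X_field) metis
  qed
  show "has_adjoint_field (psi_field \<psi> a)" for a
  proof -
    have adj: "cinner (psi_field \<psi> a k (tens u v)) (tens u' v') =
        cinner (tens u v) (psi_field \<psi> a (- 1 - k) (tens u' v'))" for k u v u' v'
      by (simp only: \<psi>_tens cinner_tens psi_field_relations(3)[OF fermions])
    have "cinner (psi_field \<psi> a k u) v = cinner u (psi_field \<psi> a (- 1 - k) v)" for k u v
      by (rule adjoint_if_on_span[OF \<psi>_lin \<psi>_lin _ span]) (clarify, rule adj)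
    then show ?thesis
      unfolding has_adjoint_field_def
      by (intro exI[of _ "psi_field \<psi> a"] conjI \<psi>_field) simp
  qed
  show "X a m (X b n v) = X b n (X a m v) +
      (\<Sum>c\<in>UNIV. (\<i> * of_real (\<Gamma> a b c)) *\<^sub>C X c (m + n) v) +
      (if a = b \<and> m + n = 0 then (of_int m * of_nat level) *\<^sub>C v else 0)" for a b m n v
  proof (rule clinear_eq_on_span[where f = "\<lambda>v. X a m (X b n v)" and v = v, OF _ _ _ span])
    show "clinear (\<lambda>v. X a m (X b n v))"
      by (rule clinear_compose[OF X_lin X_lin])
    \<comment> \<open>Written as multiplication by a scalar, the conditional central term is visibly
      linear.\<close>
    have "clinear (\<lambda>v. (if a = b \<and> m + n = 0 then of_int m * of_nat level else 0) *\<^sub>C (v::'h))"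
      by (intro clinearI) (simp_all add: cvec.scale_right_distrib mult.commute)
    moreover have "(\<lambda>v::'h. (if a = b \<and> m + n = 0 then of_int m * of_nat level else 0) *\<^sub>C v) =
      (\<lambda>v. if a = b \<and> m + n = 0 then (of_int m * of_nat level) *\<^sub>C v else 0)"
      by auto
    ultimately show "clinear (\<lambda>v. X b n (X a m v) +
        (\<Sum>c\<in>UNIV. (\<i> * of_real (\<Gamma> a b c)) *\<^sub>C X c (m + n) v) +
        (if a = b \<and> m + n = 0 then (of_int m * of_nat level) *\<^sub>C v else 0))"
      by (intro clinear_plus clinear_compose[OF X_lin X_lin] clinear_lincomb X_lin) simp
    fix w assume "w \<in> ?V"
    then obtain u v where w: "w = tens u v" by blast
    have "XL a m (XL b n u) - XL b n (XL a m u) =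
        (\<Sum>c\<in>UNIV. (\<i> * of_real (\<Gamma> a b c)) *\<^sub>C XL c (m + n) u) +
        (if a = b \<and> m + n = 0 then (of_int m * of_nat level) *\<^sub>C u else 0)"
      using bosons unfolding boson_vacuum_rep_def by blast
    then have "XL a m (XL b n u) = XL b n (XL a m u) +
        (\<Sum>c\<in>UNIV. (\<i> * of_real (\<Gamma> a b c)) *\<^sub>C XL c (m + n) u) +
        (if a = b \<and> m + n = 0 then (of_int m * of_nat level) *\<^sub>C u else 0)"
      by (simp add: algebra_simps)
    then show "X a m (X b n w) = X b n (X a m w) +
        (\<Sum>c\<in>UNIV. (\<i> * of_real (\<Gamma> a b c)) *\<^sub>C X c (m + n) w) +
        (if a = b \<and> m + n = 0 then (of_int m * of_nat level) *\<^sub>C w else 0)"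
      by (simp add: w X_tens clinear_add[OF tens1] clinear_sum[OF tens1] clinear_scaleC[OF tens1]
          clinear_zero[OF tens1])
  qed
  show "psi_field \<psi> a m (psi_field \<psi> b n v) =
      - psi_field \<psi> b n (psi_field \<psi> a m v) + (if a = b \<and> m + n = - 1 then v else 0)" for a b m n v
  proof (rule clinear_eq_on_span[where f = "\<lambda>v. psi_field \<psi> a m (psi_field \<psi> b n v)"
        and v = v, OF _ _ _ span])
    show "clinear (\<lambda>v. psi_field \<psi> a m (psi_field \<psi> b n v))"
      by (rule clinear_compose[OF \<psi>_lin \<psi>_lin])
    show "clinear (\<lambda>v. - psi_field \<psi> b n (psi_field \<psi> a m v)
        + (if a = b \<and> m + n = - 1 then v else 0))"
      by (intro clinearI)
        (simp_all add: clinear_add[OF \<psi>_lin] clinear_scaleC[OF \<psi>_lin] cvec.scale_right_diff_distrib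
          cvec.scale_right_distrib)
    fix w assume "w \<in> ?V"
    then obtain u v where w: "w = tens u v" by blast
    have minus: "tens u (- v') = - tens u v'" for v'
      using clinear_diff[OF tens2, of u 0 v'] by (simp add: clinear_zero[OF tens2])
    show "psi_field \<psi> a m (psi_field \<psi> b n w) =
        - psi_field \<psi> b n (psi_field \<psi> a m w) + (if a = b \<and> m + n = - 1 then w else 0)"
      using psi_field_relations(2)[OF fermions, of a m b n v]
      by (simp add: w \<psi>_tens clinear_add[OF tens2] clinear_diff[OF tens2]
          clinear_zero[OF tens2] minus)
  qed
  show "X a m (psi_field \<psi> b n v) = psi_field \<psi> b n (X a m v)" for a b m n v
    by (rule clinear_eq_on_span[OF clinear_compose[OF X_lin \<psi>_lin] clinear_compose[OF \<psi>_lin X_lin]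
          _ span]) (auto simp: X_tens \<psi>_tens)
  show "\<Gamma> a b c = - \<Gamma> b a c" for a b c
    by (rule conjunct1[OF antisym[rule_format]])
  show "\<Gamma> a b c = - \<Gamma> a c b" for a b c
    by (rule conjunct2[OF antisym[rule_format]])
qed (rule jacobi casimir)+


section \<open>Operator product expansions\<close>

text \<open>The n-th product takes an n-th difference in the mode of the left field. The commutators
  here are constant or linear in that mode, so these two sums decide which products survive.\<close>

lemma alternating_binomial_sum:
  "(\<Sum>p\<le>n. (- 1) ^ p * of_nat (n choose p)) = (if n = 0 then 1 else 0 :: complex)"
  using choose_alternating_sum[of n] by auto

lemma alternating_binomial_linear_sum:
  "(\<Sum>p\<le>n. (- 1) ^ p * of_nat (n choose p) * of_int (int n - int p)) =
    (if n = 1 then 1 else 0 :: complex)"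
proof (cases n)
  case (Suc k)
  have "of_nat (n choose p) * (of_int (int n - int p) :: complex) =
      of_nat n * of_nat (k choose p)" if "p \<le> n" for p
  proof -
    have "(n choose p) * (n - p) = n * (k choose p)"
      using binomial_absorb_comp[of n p] by (simp add: Suc mult.commute)
    then show ?thesis
      using that by (metis of_int_of_nat_eq of_nat_diff of_nat_mult)
  qed
  then have "(\<Sum>p\<le>n. (- 1) ^ p * of_nat (n choose p) * (of_int (int n - int p) :: complex)) =
      (\<Sum>p\<le>n. of_nat n * ((- 1) ^ p * of_nat (k choose p)))"
    by (intro sum.cong refl) (simp add: mult.assoc mult.left_commute)
  \<comment> \<open>The term p = n drops out because (k choose n) = 0 for n = k + 1.\<close>
  also have "\<dots> = of_nat n * (\<Sum>p\<le>k. (- 1) ^ p * of_nat (k choose p))"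
    by (simp add: Suc sum_distrib_left)
  finally show ?thesis
    by (simp add: alternating_binomial_sum Suc)
qed simp

text \<open>At fixed total mode the commutator is linear in the mode of B. Its second difference
  vanishes, which gives locality, and only the product n = 1 is nonzero.\<close>

lemma (in susy_modes) ope_B_G:
  assumes "d = real level + real g"
  shows "ope 0 (B a) (G_field \<Gamma> d X \<psi>) [\<lambda>n v. 0, \<lambda>n v. of_real (sqrt d) *\<^sub>C \<Psi> a n v]"
proof -
  have comm: "super_commutator 0 (B a m) (G_field \<Gamma> d X \<psi> n) v =
      (of_int m * of_real (sqrt d)) *\<^sub>C \<Psi> a (n + m - 1) v" for m n v
    by (simp add: super_commutator_def B_G[OF assms])
  have "mutually_local 0 (B a) (G_field \<Gamma> d X \<psi>)"
  proof (rule mutually_localI[OF B_is_field B_adjoint G_is_field G_adjoint])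
    fix m n v
    have "(of_int (m + 2) * of_real (sqrt d)) - 2 * (of_int (m + 1) * of_real (sqrt d)) +
        of_int m * of_real (sqrt d) = (0::complex)"
      by (simp add: algebra_simps)
    then have "((of_int (m + 2) * of_real (sqrt d)) - 2 * (of_int (m + 1) * of_real (sqrt d)) +
        of_int m * of_real (sqrt d)) *\<^sub>C \<Psi> a (n + m + 1) v = 0"
      by simp
    then show "super_commutator 0 (B a (m + 2)) (G_field \<Gamma> d X \<psi> n) v
      - 2 *\<^sub>C super_commutator 0 (B a (m + 1)) (G_field \<Gamma> d X \<psi> (n + 1)) v
      + super_commutator 0 (B a m) (G_field \<Gamma> d X \<psi> (n + 2)) v = 0"
      unfolding comm
      by (simp add: cvec.scale_left_diff_distrib cvec.scale_left_distrib add_ac)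
  qed
  moreover have nth: "nth_product 0 (int n) (B a) (G_field \<Gamma> d X \<psi>) =
      (\<lambda>m v. (if n = 1 then of_real (sqrt d) else 0) *\<^sub>C \<Psi> a m v)" for n
  proof (intro ext)
    fix m v
    have "nth_product 0 (int n) (B a) (G_field \<Gamma> d X \<psi>) m v =
      ((\<Sum>p\<le>n. (- 1) ^ p * of_nat (n choose p) * of_int (int n - int p)) * of_real (sqrt d))
        *\<^sub>C \<Psi> a (m + int n - 1) v"
      unfolding nth_product_def comm sum_distrib_right cvec.scale_sum_left
      by (simp add: mult.assoc algebra_simps)
    then show "nth_product 0 (int n) (B a) (G_field \<Gamma> d X \<psi>) m v =
        (if n = 1 then of_real (sqrt d) else 0) *\<^sub>C \<Psi> a m v"
      unfolding alternating_binomial_linear_sum by simp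
  qed
  ultimately show ?thesis
    unfolding ope_def by (simp add: nth less_Suc_eq_0_disj all_conj_distrib)
qed

text \<open>The anticommutator depends only on the total mode: second differences vanish and only n
  = 0 survives.\<close>

lemma (in susy_modes) ope_psi_G:
  "ope 1 (\<Psi> a) (G_field \<Gamma> d X \<psi>) [\<lambda>n v. of_real (1 / sqrt d) *\<^sub>C B a n v]"
proof -
  have comm: "super_commutator 1 (\<Psi> a m) (G_field \<Gamma> d X \<psi> n) v =
      of_real (1 / sqrt d) *\<^sub>C B a (n + m) v" for m n v
    by (simp add: super_commutator_def psi_G)
  have "mutually_local 1 (\<Psi> a) (G_field \<Gamma> d X \<psi>)"
  proof (rule mutually_localI[OF psi_field psi_adjoint G_is_field G_adjoint])
    fix m n v
    have "(1 - 2 + 1 :: complex) *\<^sub>C of_real (1 / sqrt d) *\<^sub>C B a (n + m + 2) v = 0"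
      by simp
    then show "super_commutator 1 (\<Psi> a (m + 2)) (G_field \<Gamma> d X \<psi> n) v
      - 2 *\<^sub>C super_commutator 1 (\<Psi> a (m + 1)) (G_field \<Gamma> d X \<psi> (n + 1)) v
      + super_commutator 1 (\<Psi> a m) (G_field \<Gamma> d X \<psi> (n + 2)) v = 0"
      unfolding comm cvec.scale_left_distrib cvec.scale_left_diff_distrib cvec.scale_one
      by (simp add: add_ac)
  qed
  moreover have nth: "nth_product 1 (int n) (\<Psi> a) (G_field \<Gamma> d X \<psi>) =
      (\<lambda>m v. (if n = 0 then of_real (1 / sqrt d) else 0) *\<^sub>C B a m v)" for n
  proof (intro ext)
    fix m v
    have "nth_product 1 (int n) (\<Psi> a) (G_field \<Gamma> d X \<psi>) m v =
      (\<Sum>p\<le>n. (- 1) ^ p * of_nat (n choose p)) *\<^sub>C of_real (1 / sqrt d) *\<^sub>C B a (m + int n) v"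
      unfolding nth_product_def comm cvec.scale_sum_left
      by (simp add: algebra_simps)
    then show "nth_product 1 (int n) (\<Psi> a) (G_field \<Gamma> d X \<psi>) m v =
        (if n = 0 then of_real (1 / sqrt d) else 0) *\<^sub>C B a m v"
      unfolding alternating_binomial_sum by simp
  qed
  moreover from nth[of 0]
  have "nth_product 1 (int 0) (\<Psi> a) (G_field \<Gamma> d X \<psi>) = (\<lambda>m v. of_real (1 / sqrt d) *\<^sub>C B a m v)"
    by simp
  ultimately show ?thesis
    unfolding ope_def by (auto simp del: of_nat_0 One_nat_def)
qed

theorem proposition4p39:
  fixes br :: "'g::complex_vector \<Rightarrow> 'g \<Rightarrow> 'g"
    and K :: "'g \<Rightarrow> 'g \<Rightarrow> complex"
    and x :: "'i::finite \<Rightarrow> 'g"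
    and \<Gamma> :: "'i \<Rightarrow> 'i \<Rightarrow> 'i \<Rightarrow> real"
    and g level :: nat
    and d :: real
    and XL :: "'i \<Rightarrow> int \<Rightarrow> 'l::complex_inner \<Rightarrow> 'l"
    and \<psi>F :: "'i \<Rightarrow> rat \<Rightarrow> 'f::complex_inner \<Rightarrow> 'f"
    and \<Omega>L :: 'l
    and \<Omega>F :: 'f
    and tens :: "'l \<Rightarrow> 'f \<Rightarrow> 'h::complex_inner"
    and X :: "'i \<Rightarrow> int \<Rightarrow> 'h \<Rightarrow> 'h"
    and \<psi> :: "'i \<Rightarrow> rat \<Rightarrow> 'h \<Rightarrow> 'h"
    and B :: "'i \<Rightarrow> 'h field_series"
    and G :: "'h field_series"
    and Gm :: "rat \<Rightarrow> 'h \<Rightarrow> 'h"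
  assumes simple: "simple_lie_algebra br"
    and basis: "is_cbasis x"
    and structure_constants:
      "\<forall>a b. br (x a) (x b) = (\<Sum>c\<in>UNIV. (\<i> * of_real (\<Gamma> a b c)) *\<^sub>C x c)"
    and antisymmetric: "\<forall>a b c. \<Gamma> a b c = - \<Gamma> b a c \<and> \<Gamma> a b c = - \<Gamma> a c b"
    and normalized: "normalized_form br K"
    and orthonormal: "\<forall>a b. K (x a) (x b) = (if a = b then 1 else 0)"
    and dual_coxeter: "is_dual_coxeter_number br g"
    and d: "d = real level + real g"
    and bosons: "boson_vacuum_rep \<Gamma> level XL \<Omega>L"
    and fermions: "fermion_vacuum_rep \<psi>F \<Omega>F"
    and tensor: "is_tensor_product tens"
    and X: "\<forall>a n. acts_on_first tens (XL a n) (X a n)"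
    and \<psi>: "\<forall>a. \<forall>m\<in>half_ints. acts_on_second tens (\<psi>F a m) (\<psi> a m)"
    and B: "B = B_field \<Gamma> X \<psi>"
    and G: "G = G_field \<Gamma> d X \<psi>"
    and Gm: "Gm = G_mode \<Gamma> d X \<psi>"
  shows "(\<forall>a. ope 0 (B a) G
              [\<lambda>n v. 0, \<lambda>n v. of_real (sqrt d) *\<^sub>C psi_field \<psi> a n v]) \<and>
         (\<forall>a. ope 1 (psi_field \<psi> a) G
              [\<lambda>n v. of_real (1 / sqrt d) *\<^sub>C B a n v]) \<and>
         (\<forall>a. \<forall>m\<in>half_ints. \<forall>n::int. \<forall>v.
            super_commutator 0 (Gm m) (B a n) v =
              (- of_int n * of_real (sqrt d)) *\<^sub>C \<psi> a (m + of_int n) v) \<and>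
         (\<forall>a. \<forall>m\<in>half_ints. \<forall>n\<in>half_ints. \<forall>v.
            super_commutator 1 (Gm m) (\<psi> a n) v =
              of_real (1 / sqrt d) *\<^sub>C B a \<lfloor>m + n\<rfloor> v)"
proof -
  have lie: "lie_bracket br" using simple by (simp add: simple_lie_algebra_def)
  interpret susy_modes \<Gamma> level g X \<psi>
    using antisymmetric structure_constants_jacobi[OF lie basis structure_constants]
      structure_constants_casimir[OF lie basis structure_constants antisymmetric normalized
        orthonormal dual_coxeter] bosons fermions tensor X \<psi>
    by (rule susy_modes_tensor)
  have "super_commutator 0 (Gm m) (B a n) v =
      (- of_int n * of_real (sqrt d)) *\<^sub>C \<psi> a (m + of_int n) v" if m: "m \<in> half_ints" for a m n v
  proof -
    \<comment> \<open>G_m is the field mode k + 1, which absorbs the -1 in the fermion index of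
      \<open>B_G\<close>. Reversing the commutator turns n into -n.\<close>
    obtain k where k: "m = of_int k + 1 / 2" using m by (auto simp: half_ints_def)
    have "\<lfloor>m + 1 / 2\<rfloor> = k + 1" by (simp add: k)
    moreover have "\<Psi> a (k + n) v = \<psi> a (m + of_int n) v"
      by (simp add: psi_field_def k add_ac)
    ultimately show ?thesis
      using B_G[OF d, of a n "k + 1" v]
      by (simp add: Gm G_mode_def B super_commutator_def)
  qed
  moreover have "super_commutator 1 (Gm m) (\<psi> a n) v =
      of_real (1 / sqrt d) *\<^sub>C B a \<lfloor>m + n\<rfloor> v"
    if m: "m \<in> half_ints" and n: "n \<in> half_ints" for a m n v
  proof -
    obtain k l where k: "m = of_int k + 1 / 2" and l: "n = of_int l + 1 / 2"
      using m n by (auto simp: half_ints_def)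
    \<comment> \<open>The sum of two half-integers is an integer, so the floor in the statement is
      exact.\<close>
    have "m + n = of_int (k + 1 + l)" by (simp add: k l)
    then have "\<lfloor>m + n\<rfloor> = k + 1 + l" by (simp only: floor_of_int)
    moreover have "\<lfloor>m + 1 / 2\<rfloor> = k + 1" by (simp add: k)
    ultimately show ?thesis
      using psi_G[of a l d "k + 1" v]
      by (simp add: Gm G_mode_def B super_commutator_def psi_field_def flip: l)
  qed
  ultimately show ?thesis
    using ope_B_G[OF d] ope_psi_G unfolding B G by blast
qed

end
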